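(* Let $\mathbf{X}$ be an isotropic unimodal Lévy process on $\mathbb{R}^d$ with Lévy–Khintchine exponent $\psi\in\Pi^\infty_\ell$ for some bounded $\ell\in\mathcal{R}^\infty_0$. Then \[ \lim_{t\to0^+,\ t\psi(|x|^{-1})\to\infty}\frac{p(t,x)}{t|x|^{-d}\ell(|x|^{-1})e^{-t\psi(|x|^{-1})}}=\frac{\Gamma(d/2)}{2\pi^{d/2}}. \]
   Context: An isotropic unimodal Lévy process on $\mathbb{R}^d$ is a pure-jump Lévy process $\mathbf{X}=(X_t)_{t\ge0}$, $X_0=0$, with $\mathbb{E}e^{i\langle\xi,X_t\rangle}=e^{-t\psi(\xi)}$, $\psi(\xi)=\int_{\mathbb{R}^d}(1-\cos\langle\xi,x\rangle)\,\nu(\mathrm{d}x)$, where the Lévy measure has a radial, radially non-increasing density $\nu$; for $t>0$ the law of $X_t$ on $\mathbb{R}^d\setminus\{0\}$ has a radial non-increasing density $p(t,x)$. Radial functions are written as functions of $|x|$. $\ell\in\mathcal{R}^\infty_0$ means $\ell$ positive on some $[a,\infty)$ with $\ell(\lambda x)/\ell(x)\to1$ as $x\to\infty$ for all $\lambda>0$; $\Pi^\infty_\ell$ is the set of $f:[a,\infty)\to[0,\infty)$ with $\lim_{x\to\infty}(f(\lambda x)-f(x))/\ell(x)=\log\lambda$ for all $\lambda>0$. The joint limit is along all sequences $t_n\to0^+$, $x_n\neq0$, with $t_n\psi(|x_n|^{-1})\to\infty$. *)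

theory Defs
  imports "HOL-Probability.Probability"
begin

definition radial :: "('a::euclidean_space \<Rightarrow> real) \<Rightarrow> bool" where
  "radial f \<longleftrightarrow> (\<forall>x y. norm x = norm y \<longrightarrow> f x = f y)"

definition radially_nonincreasing :: "('a::euclidean_space \<Rightarrow> real) \<Rightarrow> bool" where
  "radially_nonincreasing f \<longleftrightarrow> (\<forall>x y. 0 < norm x \<and> norm x \<le> norm y \<longrightarrow> f y \<le> f x)"

definition levy_density :: "('a::euclidean_space \<Rightarrow> real) \<Rightarrow> bool" where
  "levy_density \<nu> \<longleftrightarrow> \<nu> \<in> borel_measurable lborel \<and> (\<forall>x. 0 \<le> \<nu> x) \<and>
     (\<integral>\<^sup>+ x. ennreal (min 1 ((norm x)\<^sup>2) * \<nu> x) \<partial>lborel) < \<infinity>"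

definition levy_exponent :: "('a::euclidean_space \<Rightarrow> real) \<Rightarrow> 'a \<Rightarrow> real" where
  "levy_exponent \<nu> \<xi> = (\<integral> x. (1 - cos (\<xi> \<bullet> x)) * \<nu> x \<partial>lborel)"

definition isotropic_unimodal_levy ::
    "'b measure \<Rightarrow> (real \<Rightarrow> 'b \<Rightarrow> 'a::euclidean_space) \<Rightarrow> ('a \<Rightarrow> real) \<Rightarrow> bool" where
  "isotropic_unimodal_levy M X \<nu> \<longleftrightarrow>
     prob_space M \<and> levy_density \<nu> \<and> radial \<nu> \<and> radially_nonincreasing \<nu> \<and>
     (\<forall>\<omega>\<in>space M. X 0 \<omega> = 0) \<and>
     (\<forall>t\<ge>0. X t \<in> borel_measurable M) \<and>
     (\<forall>t\<ge>0. \<forall>\<xi>. (CLINT x | distr M borel (X t). cis (\<xi> \<bullet> x))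
                    = complex_of_real (exp (- (t * levy_exponent \<nu> \<xi>))))"

definition transition_density ::
    "'b measure \<Rightarrow> (real \<Rightarrow> 'b \<Rightarrow> 'a::euclidean_space) \<Rightarrow> (real \<Rightarrow> 'a \<Rightarrow> real) \<Rightarrow> bool" where
  "transition_density M X p \<longleftrightarrow>
     (\<forall>t>0. p t \<in> borel_measurable lborel \<and> (\<forall>x. 0 \<le> p t x) \<and>
        (\<forall>A\<in>sets borel. emeasure (distr M borel (X t)) (A - {0})
            = (\<integral>\<^sup>+ x\<in>A - {0}. ennreal (p t x) \<partial>lborel)))"

definition slowly_varying_infty :: "(real \<Rightarrow> real) \<Rightarrow> bool" where
  "slowly_varying_infty l \<longleftrightarrow> (\<exists>a. \<forall>x\<ge>a. 0 < l x) \<and>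
     (\<forall>c>0. ((\<lambda>x. l (c * x) / l x) \<longlongrightarrow> 1) at_top)"

definition de_haan_class :: "(real \<Rightarrow> real) \<Rightarrow> (real \<Rightarrow> real) \<Rightarrow> bool" where
  "de_haan_class l f \<longleftrightarrow> (\<exists>a. \<forall>x\<ge>a. 0 \<le> f x) \<and>
     (\<forall>c>0. ((\<lambda>x. (f (c * x) - f x) / l x) \<longlongrightarrow> ln c) at_top)"

end

(*
  The law of |X_t| is read off from Gaussian averages: if g is a standard Gaussian vector, then
  E exp(- s^2 |X_t|^2 / 2) = E exp(- t psi(s |g|)). Since psi is in the de Haan class of a bounded l,
  t (psi(c x) - psi(x)) tends to 0 and is asymptotic to t l(x) ln c, so with w = t l(x) exp(- t psi(x))
  the differences of these averages at s = c x and s = x, divided by w, tend to - ln c.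
  (Dominated convergence: Potter-type bounds for l and psi give a bound of order
  |g|^(1/2) + |g|^(-1/2).)
  For x = 1/|x_n| this determines the limits of all moments of y^2 (1 - y) under y = exp(- x^2 |X_t|^2 / 2),
  hence by Weierstrass' approximation theorem P(a |x_n| < |X_t| <= b |x_n|) / w tends to ln(b/a).
  Since p(t,.) is radially decreasing, its value at x_n is squeezed between the averages of p(t,.)
  over thin annuli on both sides of |x_n|; letting their width tend to 0 gives 1 / (d vol(B_1)).
*)
theory Submission
  imports Defs
begin

text \<open>The limit measure ds / s is infinite at both ends, so a single Gaussian average divided
  by w cannot be read as a finite moment of it; only differences of averages are. The weight y^2 (1
  - y) reflects this: 1 - y turns a moment into such a difference and tempers small radii (y near
  1), and y^2 instead of y also makes the limiting density continuous at y = 0. The obstacle is the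
  domination. For small |g| the argument x |g| need not be large, the de Haan condition says nothing
  about \<psi>(x |g|), and the numerator can only be bounded by 1, so that all of 1 / w has to be
  paid for. This is affordable: t \<psi>(x) \<ge> 1 bounds 1 / t by \<psi>(x), which grows at most
  logarithmically; 1 / l(x) is at most a small power of x; exp(t \<psi>(x)) is a small power as well
  once t is small. If x |g| stays below a fixed threshold, a power of x is at most a constant times
  the same power of 1 / |g|, and small negative powers of |g| are integrable in every
  dimension.\<close>

section \<open>Uniform bounds for increments\<close>

text \<open>If the bound failed along \<open>X n\<close>, \<open>U n\<close>, the sets of shifts that are good for \<open>X n\<close> and for
  \<open>X n + U n\<close> would each have measure above \<open>3/2\<close> but would be disjoint inside \<open>{0..3}\<close>.\<close>

lemma uniformly_bounded_increments:
  fixes f :: "real \<Rightarrow> real"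
  assumes f[measurable]: "f \<in> borel_measurable borel"
    and bd: "\<And>u. u \<in> {0..2} \<Longrightarrow> eventually (\<lambda>x. \<bar>f (x + u) - f x\<bar> \<le> K) at_top"
  shows "\<exists>x0. \<forall>x\<ge>x0. \<forall>u\<in>{0..1}. \<bar>f (x + u) - f x\<bar> \<le> 2 * K"
proof (rule ccontr)
  assume "\<not> ?thesis"
  then have "\<forall>n::nat. \<exists>x u. x \<ge> real n \<and> u \<in> {0..1} \<and> \<bar>f (x + u) - f x\<bar> > 2 * K"
    by (meson not_le)
  then obtain X U where X: "\<And>n::nat. X n \<ge> real n" and U: "\<And>n. U n \<in> {0..1::real}"
    and XU: "\<And>n. \<bar>f (X n + U n) - f (X n)\<bar> > 2 * K"
    by metis
  have large: "\<exists>n. measure lborel {v \<in> {0..2}. \<forall>m\<ge>n. \<bar>f (Y m + v) - f (Y m)\<bar> \<le> K} > 3/2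
      \<and> n \<ge> N" if Y: "\<And>n::nat. Y n \<ge> real n" for Y N
  proof -
    let ?V = "\<lambda>n. {v \<in> {0..2}. \<forall>m\<ge>n. \<bar>f (Y m + v) - f (Y m)\<bar> \<le> K}"
    have lim: "filterlim Y at_top sequentially"
      using Y by (intro filterlim_at_top_mono[OF filterlim_real_sequentially]) auto
    have "(\<Union>n. ?V n) = {0..2}"
    proof (intro equalityI subsetI)
      fix v :: real assume v: "v \<in> {0..2}"
      have "eventually (\<lambda>n. \<bar>f (Y n + v) - f (Y n)\<bar> \<le> K) sequentially"
        using filterlim_iff[THEN iffD1, OF lim] bd[OF v] by blast
      then show "v \<in> (\<Union>n. ?V n)" using v by (auto simp: eventually_sequentially)
    qed auto
    moreover have "incseq ?V" by (auto simp: incseq_def)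
    moreover have "range ?V \<subseteq> sets lborel" by auto
    moreover have "emeasure lborel (?V n) \<noteq> \<infinity>" for n
    proof -
      have "emeasure lborel (?V n) \<le> emeasure lborel {0..2::real}"
        by (intro emeasure_mono) auto
      then show ?thesis by (auto simp: top_unique)
    qed
    ultimately have "(\<lambda>n. measure lborel (?V n)) \<longlonglongrightarrow> measure lborel {0..2::real}"
      using Lim_measure_incseq[of ?V lborel] by (simp add: emeasure_lborel_Icc)
    then have "(\<lambda>n. measure lborel (?V n)) \<longlonglongrightarrow> 2" by simp
    then have "eventually (\<lambda>n. measure lborel (?V n) > 3/2) sequentially"
      by (rule order_tendstoD) simp
    then have "eventually (\<lambda>n. measure lborel (?V n) > 3/2 \<and> n \<ge> N) sequentially"
      using eventually_ge_at_top by (rule eventually_conj)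
    then show ?thesis using eventually_happens'[OF sequentially_bot] by fast
  qed
  define V where "V n = {v \<in> {0..2}. \<forall>m\<ge>n. \<bar>f (X m + v) - f (X m)\<bar> \<le> K}" for n
  define W where "W n = {v \<in> {0..2}. \<forall>m\<ge>n. \<bar>f (X m + U m + v) - f (X m + U m)\<bar> \<le> K}" for n
  have XU_ge: "X n + U n \<ge> real n" for n using X[of n] U[of n] by simp
  obtain n1 where n1: "measure lborel (V n1) > 3/2" using large[OF X, of 0] by (auto simp: V_def)
  obtain n where n: "measure lborel (W n) > 3/2" "n \<ge> n1"
    using large[of "\<lambda>n. X n + U n", OF XU_ge, of n1] by (auto simp: W_def)
  have [measurable]: "V k \<in> sets borel" "W k \<in> sets borel" for k by (auto simp: V_def W_def)
  \<comment> \<open>Shifting by \<open>U n\<close> lets both sets speak of the same end point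
    \<open>X n + v\<close>. A common \<open>v\<close> would put \<open>f (X n + v)\<close> within
    \<open>K\<close> of both \<open>f (X n)\<close> and \<open>f (X n + U n)\<close>, against the
    choice of \<open>U n\<close>. Since \<open>n \<ge> n1\<close>, membership in \<open>V n1\<close>
    does control the index \<open>n\<close>.\<close>
  define W' where "W' = (\<lambda>v. v - U n) -` W n"
  have W'm[measurable]: "W' \<in> sets borel"
    unfolding W'_def using measurable_sets[of "\<lambda>v. v - U n" borel borel "W n"] by simp
  have "emeasure lborel W' = emeasure (distr lborel borel ((+) (- U n))) (W n)"
    by (subst emeasure_distr) (auto simp: W'_def intro!: arg_cong2[where f=emeasure])
  also have "\<dots> = emeasure lborel (W n)" by (simp add: lborel_distr_plus)
  finally have mW': "measure lborel W' = measure lborel (W n)" by (simp add: measure_def)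
  have sub: "V n1 \<subseteq> {0..3}" "W' \<subseteq> {0..3}" using U[of n] by (auto simp: V_def W'_def W_def)
  have fin: "{0..3::real} \<in> fmeasurable lborel" by (simp add: fmeasurable_def)
  have f1: "V n1 \<in> fmeasurable lborel" by (rule fmeasurableI2[OF fin sub(1)]) simp
  have f2: "W' \<in> fmeasurable lborel" by (rule fmeasurableI2[OF fin sub(2)]) simp
  have "V n1 \<inter> W' = {}"
  proof (rule ccontr)
    assume "V n1 \<inter> W' \<noteq> {}"
    then obtain v where v: "v \<in> V n1" "v - U n \<in> W n" by (auto simp: W'_def)
    have "\<bar>f (X n + v) - f (X n)\<bar> \<le> K" using v(1) n(2) by (auto simp: V_def)
    moreover have "\<bar>f (X n + U n + (v - U n)) - f (X n + U n)\<bar> \<le> K" using v(2) by (auto simp: W_def)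
    ultimately show False using XU[of n] by (simp add: algebra_simps)
  qed
  then have "measure lborel (V n1) + measure lborel W' = measure lborel (V n1 \<union> W')"
    using f1 f2 by (subst measure_Union) (auto simp: fmeasurable_def)
  also have "\<dots> \<le> measure lborel {0..3::real}"
    using sub fin by (intro measure_mono_fmeasurable) auto
  finally show False using n n1 mW' by simp
qed

text \<open>Unit steps are chained from the smaller to the larger point; the fractional remainder
  costs one more step, hence the summand 1.\<close>

lemma linearly_bounded_increments:
  fixes f :: "real \<Rightarrow> real"
  assumes f: "f \<in> borel_measurable borel"
    and bd: "\<And>u. u \<in> {0..2} \<Longrightarrow> eventually (\<lambda>x. \<bar>f (x + u) - f x\<bar> \<le> K) at_top"
  shows "\<exists>x0. \<forall>x\<ge>x0. \<forall>y\<ge>x0. \<bar>f y - f x\<bar> \<le> 2 * K * (1 + \<bar>y - x\<bar>)"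
proof -
  obtain x0 where x0: "\<And>x u. x \<ge> x0 \<Longrightarrow> u \<in> {0..1} \<Longrightarrow> \<bar>f (x + u) - f x\<bar> \<le> 2 * K"
    using uniformly_bounded_increments[OF f bd] by blast
  have K: "K \<ge> 0" using x0[of x0 0] by simp
  have step: "\<bar>f (x + real n + u) - f x\<bar> \<le> 2 * K * (1 + real n)"
    if "x \<ge> x0" "u \<in> {0..1}" for x u and n :: nat
    using that(1)
  proof (induction n arbitrary: x)
    case 0 then show ?case using x0[of x u] that by simp
  next
    case (Suc n)
    have "\<bar>f (x + 1 + real n + u) - f (x + 1)\<bar> \<le> 2 * K * (1 + real n)" using Suc by simp
    moreover have "\<bar>f (x + 1) - f x\<bar> \<le> 2 * K" using x0[of x 1] Suc by simp
    ultimately show ?case by (simp add: algebra_simps)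
  qed
  have le: "\<bar>f y - f x\<bar> \<le> 2 * K * (1 + \<bar>y - x\<bar>)" if "x \<ge> x0" "y \<ge> x" for x y
  proof -
    define n where "n = nat \<lfloor>y - x\<rfloor>"
    have n: "real n \<le> y - x" "y - x - real n \<in> {0..1}"
      using that by (auto simp: n_def) linarith+
    have "\<bar>f (x + real n + (y - x - real n)) - f x\<bar> \<le> 2 * K * (1 + real n)"
      using that n by (intro step) auto
    also have "\<dots> \<le> 2 * K * (1 + \<bar>y - x\<bar>)" using K n that by (intro mult_left_mono) auto
    finally show ?thesis by simp
  qed
  show ?thesis
  proof (intro exI[of _ x0] allI impI)
    fix x y assume "x \<ge> x0" "y \<ge> x0"
    then show "\<bar>f y - f x\<bar> \<le> 2 * K * (1 + \<bar>y - x\<bar>)"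
      using le[of x y] le[of y x] by (cases "x \<le> y") (auto simp: abs_minus_commute)
  qed
qed

text \<open>The substitution \<open>x = exp v\<close> turns factors in [1, e^2] into shifts in
  [0, 2]. For \<open>F = ln \<circ> l\<close> this is a Potter bound with exponent
  \<open>2 * K\<close>; for \<open>F = \<psi>\<close> it says that \<psi> grows at most
  logarithmically.\<close>

lemma logarithmically_bounded_increments:
  fixes F :: "real \<Rightarrow> real"
  assumes F: "(\<lambda>v. F (exp v)) \<in> borel_measurable borel"
    and bd: "\<And>c. 1 \<le> c \<Longrightarrow> c \<le> exp 2 \<Longrightarrow> eventually (\<lambda>x. \<bar>F (c * x) - F x\<bar> \<le> K) at_top"
  shows "\<exists>x0>0. \<forall>x\<ge>x0. \<forall>y\<ge>x0. \<bar>F y - F x\<bar> \<le> 2 * K * (1 + \<bar>ln y - ln x\<bar>)"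
proof -
  have "eventually (\<lambda>x. \<bar>F (exp (x + u)) - F (exp x)\<bar> \<le> K) at_top" if "u \<in> {0..2}" for u
  proof -
    have "eventually (\<lambda>x. \<bar>F (exp u * exp x) - F (exp x)\<bar> \<le> K) at_top"
      using bd[of "exp u"] that exp_at_top unfolding filterlim_iff by auto
    then show ?thesis by (simp add: exp_add mult.commute)
  qed
  from linearly_bounded_increments[OF F this] obtain x0 where
    x0: "\<And>x y. x \<ge> x0 \<Longrightarrow> y \<ge> x0 \<Longrightarrow> \<bar>F (exp y) - F (exp x)\<bar> \<le> 2 * K * (1 + \<bar>y - x\<bar>)"
    by blast
  show ?thesis
  proof (intro exI[of _ "exp x0"] conjI allI impI)
    fix x y assume "x \<ge> exp x0" "y \<ge> exp x0"
    moreover from this have "x > 0" "y > 0" by (auto intro: less_le_trans[OF exp_gt_zero])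
    ultimately show "\<bar>F y - F x\<bar> \<le> 2 * K * (1 + \<bar>ln y - ln x\<bar>)"
      using x0[of "ln x" "ln y"] by (simp add: ln_ge_iff)
  qed simp
qed

section \<open>The standard Gaussian vector\<close>

text \<open>Supplies the domination near \<open>g = 0\<close>. Any exponent above -1 would be
  integrable; -1/2 leaves enough room for the powers collected in
  \<open>exponent_increment_bound\<close>.\<close>

lemma integrable_std_normal_powr_neg_half:
  "integrable std_normal_distribution (\<lambda>s. \<bar>s\<bar> powr (-1/2))"
proof -
  have le1: "std_normal_density s \<le> 1" for s
  proof -
    have "sqrt (2 * pi) \<ge> 1" using pi_ge_two by (intro real_le_rsqrt) auto
    moreover have "exp (- s\<^sup>2 / 2) \<le> 1" by simp
    ultimately have "exp (- s\<^sup>2 / 2) \<le> sqrt (2 * pi)" by linarith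
    then show ?thesis unfolding std_normal_density_def by (simp add: divide_simps)
  qed
  have pos: "set_integrable lborel {0..1} (\<lambda>s::real. s powr (-1/2))"
  proof -
    have "((\<lambda>s::real. s powr (-1/2)) has_integral (1 powr (-1/2 + 1) / (-1/2 + 1))) {0..1}"
      by (rule has_integral_powr_from_0) auto
    then have "(\<lambda>s::real. s powr (-1/2)) absolutely_integrable_on {0..1}"
      by (intro nonnegative_absolutely_integrable_1) (auto simp: integrable_on_def)
    then show ?thesis
      unfolding set_integrable_def by (subst (asm) integrable_completion) auto
  qed
  have "integrable lborel (\<lambda>s::real. indicator {0..1} s *\<^sub>R s powr (-1/2) +
      indicator {0..1} (- s) *\<^sub>R (- s) powr (-1/2) + std_normal_density s)"
    using pos lborel_integrable_real_affine[of "\<lambda>s. indicator {0..1} s *\<^sub>R s powr (-1/2)" "-1" 0]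
    by (intro Bochner_Integration.integrable_add integrable_normal_density)
       (auto simp: set_integrable_def)
  then have "integrable lborel (\<lambda>s. std_normal_density s *\<^sub>R \<bar>s\<bar> powr (-1/2))"
  proof (rule Bochner_Integration.integrable_bound)
    show "AE s in lborel. norm (std_normal_density s *\<^sub>R \<bar>s\<bar> powr (-1/2)) \<le>
      norm (indicator {0..1} s *\<^sub>R s powr (-1/2) +
      indicator {0..1} (- s) *\<^sub>R (- s) powr (-1/2) + std_normal_density s)"
    proof (rule AE_I2)
      fix s :: real
      have nn: "0 \<le> std_normal_density s" by simp
      consider "0 \<le> s" "s \<le> 1" | "-1 \<le> s" "s < 0" | "\<bar>s\<bar> > 1" by linarith
      then show "norm (std_normal_density s *\<^sub>R \<bar>s\<bar> powr (-1/2)) \<le>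
        norm (indicator {0..1} s *\<^sub>R s powr (-1/2) +
        indicator {0..1} (- s) *\<^sub>R (- s) powr (-1/2) + std_normal_density s)"
      proof cases
        case 1
        then have "std_normal_density s * s powr (-1/2) \<le> 1 * s powr (-1/2)"
          using le1 by (intro mult_right_mono) auto
        then have "std_normal_density s * s powr (-1/2) \<le> s powr (-1/2) + std_normal_density s"
          using nn by linarith
        then show ?thesis using 1 by (auto simp: abs_mult indicator_def split: if_splits)
      next
        case 2
        then have "std_normal_density s * (-s) powr (-1/2) \<le> 1 * (-s) powr (-1/2)"
          using le1 by (intro mult_right_mono) auto
        then have "std_normal_density s * (-s) powr (-1/2) \<le> (-s) powr (-1/2) + std_normal_density s"
          using nn by linarith
        then show ?thesis using 2 by (auto simp: abs_mult)
      next
        case 3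
        then have "\<bar>s\<bar> powr (-1/2) \<le> 1"
          using powr_mono2'[of "-1/2" 1 "\<bar>s\<bar>"] by simp
        then have "std_normal_density s * \<bar>s\<bar> powr (-1/2) \<le> std_normal_density s * 1"
          using nn by (intro mult_left_mono) auto
        then show ?thesis using 3 nn by (auto simp: abs_mult indicator_def)
      qed
    qed
  qed simp
  then show ?thesis by (subst integrable_density) auto
qed

lemma integrable_std_normal_abs: "integrable std_normal_distribution (\<lambda>s. \<bar>s\<bar>)"
  using integrable_std_normal_moment_abs[of 1]
  by (subst integrable_density) auto

text \<open>The integrable function is the shape of the majorant in the dominated convergence below.
  The null set \<open>g = 0\<close> has to be excluded because there the difference quotient is
  identically 0 and does not tend to \<open>- ln c\<close>.\<close>

lemma standard_gaussian_exists:
  obtains \<gamma> :: "'a::euclidean_space measure" where "prob_space \<gamma>" "sets \<gamma> = sets borel"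
    "\<And>z. (\<integral>g. cos (z \<bullet> g) \<partial>\<gamma>) = exp (- (norm z)\<^sup>2 / 2)"
    "integrable \<gamma> (\<lambda>g. norm g powr (1/2) + norm g powr (-1/2))"
    "AE g in \<gamma>. g \<noteq> 0"
proof -
  let ?N = "std_normal_distribution"
  let ?P = "Pi\<^sub>M (Basis :: 'a set) (\<lambda>_. ?N)"
  define e where "e f = (\<Sum>b\<in>Basis. f b *\<^sub>R b :: 'a)" for f
  interpret N: prob_space ?N by (rule prob_space_normal_density) simp
  interpret P: product_prob_space "\<lambda>_. ?N" "Basis :: 'a set" by unfold_locales
  have prP: "prob_space ?P" by (rule prob_space_PiM) (rule N.prob_space_axioms)
  have [measurable]: "e \<in> measurable ?P borel" unfolding e_def by measurable
  define \<gamma> where "\<gamma> = distr ?P borel e"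
  have eb: "e f \<bullet> b = f b" if "b \<in> Basis" for f b
    using that by (simp add: e_def inner_sum_left inner_Basis if_distrib cong: if_cong)
  have comp: "integrable ?P (\<lambda>f. h (f b))" if "integrable ?N h" "b \<in> Basis"
    for h :: "real \<Rightarrow> real" and b :: 'a
  proof -
    have "distr ?P ?N (\<lambda>\<omega>. \<omega> b) = ?N"
      using that N.prob_space_axioms by (intro distr_PiM_component) auto
    then have "integrable (distr ?P ?N (\<lambda>\<omega>. \<omega> b)) h" using that by simp
    then show ?thesis by (rule integrable_distr[rotated]) (use that in measurable)
  qed
  have charf: "(\<integral>g. cis (z \<bullet> g) \<partial>\<gamma>) = exp (- (norm z)\<^sup>2 / 2)" for z
  proof -
    have "(\<integral>g. cis (z \<bullet> g) \<partial>\<gamma>) = (\<integral>f. cis (z \<bullet> e f) \<partial>?P)"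
      unfolding \<gamma>_def by (subst integral_distr) (auto simp: cis_conv_exp)
    also have "\<dots> = (\<integral>f. (\<Prod>b\<in>Basis. iexp ((z \<bullet> b) * f b)) \<partial>?P)"
      by (intro Bochner_Integration.integral_cong refl)
         (simp add: cis_conv_exp e_def inner_sum_right exp_sum[symmetric] sum_distrib_left mult_ac)
    also have "\<dots> = (\<Prod>b\<in>Basis. \<integral>s. iexp ((z \<bullet> b) * s) \<partial>?N)"
      by (intro P.product_integral_prod N.integrable_iexp) auto
    also have "\<dots> = (\<Prod>b\<in>Basis. complex_of_real (exp (- (z \<bullet> b)\<^sup>2 / 2)))"
      using char_std_normal_distribution by (simp add: char_def fun_eq_iff)
    also have "\<dots> = complex_of_real (exp (\<Sum>b\<in>Basis. - (z \<bullet> b)\<^sup>2 / 2))"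
      by (simp add: exp_sum)
    also have "(\<Sum>b\<in>Basis. - (z \<bullet> b)\<^sup>2 / 2) = - (norm z)\<^sup>2 / 2"
      by (subst euclidean_inner[of z z, folded power2_norm_eq_inner])
         (simp add: sum_negf sum_divide_distrib power2_eq_square)
    finally show ?thesis by simp
  qed
  have pr: "prob_space \<gamma>" unfolding \<gamma>_def by (rule prob_space.prob_space_distr[OF prP]) simp
  interpret G: prob_space \<gamma> by fact
  have sets: "sets \<gamma> = sets borel" by (simp add: \<gamma>_def)
  have cosi: "(\<integral>g. cos (z \<bullet> g) \<partial>\<gamma>) = exp (- (norm z)\<^sup>2 / 2)" for z
  proof -
    have "integrable \<gamma> (\<lambda>g. cis (z \<bullet> g))"
      by (intro G.integrable_const_bound[where B=1]) (auto simp: \<gamma>_def cis_conv_exp)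
    from integral_Re[OF this] show ?thesis using charf[of z] by simp
  qed
  \<comment> \<open>A single coordinate controls the negative power: the norm is at least
    \<open>\<bar>f b0\<bar>\<close>, so its power -1/2 is at most that of the coordinate. This
    reduces every dimension to the real line.\<close>
  obtain b0 :: 'a where b0: "b0 \<in> Basis" using nonempty_Basis by blast
  have ae: "AE f in ?P. f b0 \<noteq> 0"
  proof -
    have "AE s in ?N. s \<noteq> 0"
      by (subst AE_density) (auto intro: AE_mp[OF AE_lborel_singleton])
    then show ?thesis
      using N.prob_space_axioms b0 by (intro AE_PiM_component) auto
  qed
  have ae': "AE f in ?P. e f \<noteq> 0"
    using ae by eventually_elim (metis eb[OF b0] inner_zero_left)
  have "integrable ?P (\<lambda>f. norm (e f) powr (1/2) + norm (e f) powr (-1/2))"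
  proof (rule Bochner_Integration.integrable_bound)
    show "integrable ?P (\<lambda>f. 1 + (\<Sum>b\<in>Basis. \<bar>f b\<bar>) + \<bar>f b0\<bar> powr (-1/2))"
      by (intro Bochner_Integration.integrable_add Bochner_Integration.integrable_sum
         comp[OF integrable_std_normal_abs] comp[OF integrable_std_normal_powr_neg_half] b0) auto
    show "AE f in ?P. norm (norm (e f) powr (1/2) + norm (e f) powr (-1/2))
      \<le> norm (1 + (\<Sum>b\<in>Basis. \<bar>f b\<bar>) + \<bar>f b0\<bar> powr (-1/2))"
      using ae
    proof eventually_elim
      case (elim f)
      have 1: "\<bar>f b0\<bar> \<le> norm (e f)" using Basis_le_norm[OF b0, of "e f"] eb[OF b0] by simp
      have 2: "norm (e f) powr (-1/2) \<le> \<bar>f b0\<bar> powr (-1/2)"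
        using powr_mono2'[of "-1/2" "\<bar>f b0\<bar>" "norm (e f)"] 1 elim by simp
      have 3: "norm (e f) \<le> (\<Sum>b\<in>Basis. \<bar>f b\<bar>)"
        using norm_le_l1[of "e f"] eb by simp
      have 4: "norm (e f) powr (1/2) \<le> 1 + norm (e f)"
      proof (cases "norm (e f) \<le> 1")
        case True
        then have "norm (e f) powr (1/2) \<le> 1 powr (1/2)" by (intro powr_mono2) auto
        then show ?thesis by (simp add: add_increasing2)
      next
        case False
        then have "norm (e f) powr (1/2) \<le> norm (e f) powr 1" by (intro powr_mono) auto
        then show ?thesis by simp
      qed
      have "0 \<le> (\<Sum>b\<in>Basis. \<bar>f b\<bar>)" by (intro sum_nonneg) auto
      then have "norm (1 + (\<Sum>b\<in>Basis. \<bar>f b\<bar>) + \<bar>f b0\<bar> powr (-1/2)) =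
         1 + (\<Sum>b\<in>Basis. \<bar>f b\<bar>) + \<bar>f b0\<bar> powr (-1/2)"
        by (simp only: real_norm_def) (intro abs_of_nonneg add_nonneg_nonneg, auto)
      moreover have "norm (norm (e f) powr (1/2) + norm (e f) powr (-1/2)) =
          norm (e f) powr (1/2) + norm (e f) powr (-1/2)" by simp
      ultimately show ?case using 2 3 4 by linarith
    qed
  qed measurable
  then have int: "integrable \<gamma> (\<lambda>g. norm g powr (1/2) + norm g powr (-1/2))"
    unfolding \<gamma>_def by (subst integrable_distr_eq) auto
  have "AE g in \<gamma>. g \<noteq> 0" unfolding \<gamma>_def using ae' by (subst AE_distr_iff) auto
  then show thesis using that[OF pr sets cosi int] by blast
qed

section \<open>Gaussian transforms and the exponent\<close>

text \<open>The Gaussian factor at \<open>z\<close> is itself the characteristic function of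
  \<open>\<gamma>\<close> at \<open>s z\<close>. Since
  \<open>(s z) \<bullet> g = (s g) \<bullet> z\<close>, Fubini moves the scale from \<open>z\<close>
  to \<open>g\<close> and leaves the characteristic function of \<open>\<mu>\<close> at
  \<open>s g\<close>; as it is real, cosines suffice.\<close>

lemma gaussian_transform:
  fixes \<mu> \<gamma> :: "'a::euclidean_space measure"
  assumes \<mu>: "prob_space \<mu>" "sets \<mu> = sets borel" and \<gamma>: "prob_space \<gamma>" "sets \<gamma> = sets borel"
    and gauss: "\<And>z. (\<integral>g. cos (z \<bullet> g) \<partial>\<gamma>) = exp (- (norm z)\<^sup>2 / 2)"
    and charf: "\<And>\<xi>. (CLINT x | \<mu>. cis (\<xi> \<bullet> x)) = complex_of_real (\<phi> \<xi>)"
  shows "(\<integral>z. exp (- (s * norm z)\<^sup>2 / 2) \<partial>\<mu>) = (\<integral>g. \<phi> (s *\<^sub>R g) \<partial>\<gamma>)"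
proof -
  interpret M: prob_space \<mu> by fact
  interpret G: prob_space \<gamma> by fact
  interpret MG: pair_prob_space \<mu> \<gamma> ..
  note [measurable_cong] = \<mu>(2) \<gamma>(2)
  have \<phi>: "\<phi> \<xi> = (\<integral>z. cos (\<xi> \<bullet> z) \<partial>\<mu>)" for \<xi>
  proof -
    have "integrable \<mu> (\<lambda>x. cis (\<xi> \<bullet> x))"
      by (intro M.integrable_const_bound[where B=1]) (auto simp: cis_conv_exp)
    from integral_Re[OF this] show ?thesis using charf[of \<xi>] by simp
  qed
  have "(\<integral>z. exp (- (s * norm z)\<^sup>2 / 2) \<partial>\<mu>) = (\<integral>z. (\<integral>g. cos ((s *\<^sub>R z) \<bullet> g) \<partial>\<gamma>) \<partial>\<mu>)"
    by (subst gauss) (simp add: power_mult_distrib)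
  also have "\<dots> = (\<integral>g. (\<integral>z. cos ((s *\<^sub>R z) \<bullet> g) \<partial>\<mu>) \<partial>\<gamma>)"
    by (rule MG.Fubini_integral[symmetric])
       (auto intro!: MG.P.integrable_const_bound[where B=1])
  also have "\<dots> = (\<integral>g. \<phi> (s *\<^sub>R g) \<partial>\<gamma>)" by (simp add: \<phi> inner_commute)
  finally show ?thesis .
qed

lemma levy_exponent_nonneg:
  "levy_density \<nu> \<Longrightarrow> 0 \<le> levy_exponent \<nu> \<xi>"
  unfolding levy_exponent_def levy_density_def by (intro Bochner_Integration.integral_nonneg) auto

lemma levy_exponent_borel_measurable:
  assumes "levy_density \<nu>"
  shows "levy_exponent \<nu> \<in> borel_measurable borel"
proof -
  have [measurable]: "\<nu> \<in> borel_measurable borel" using assms by (simp add: levy_density_def)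
  show ?thesis unfolding levy_exponent_def[abs_def] by measurable
qed

lemma levy_exponent_le:
  fixes \<nu> :: "'a::euclidean_space \<Rightarrow> real"
  assumes \<nu>: "levy_density \<nu>"
  obtains C where "\<And>\<xi>. levy_exponent \<nu> \<xi> \<le> C * (1 + (norm \<xi>)\<^sup>2)"
proof
  have [measurable]: "\<nu> \<in> borel_measurable borel" and nn: "\<And>x. 0 \<le> \<nu> x"
    using assms by (auto simp: levy_density_def)
  have int: "integrable lborel (\<lambda>x. min 1 ((norm x)\<^sup>2) * \<nu> x)"
    using \<nu> nn by (intro integrableI_nonneg) (auto simp: levy_density_def)
  fix \<xi> :: 'a
  show "levy_exponent \<nu> \<xi> \<le> 2 * (\<integral>x. min 1 ((norm x)\<^sup>2) * \<nu> x \<partial>lborel) * (1 + (norm \<xi>)\<^sup>2)"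
  proof -
    have "(1 - cos (\<xi> \<bullet> x)) * \<nu> x \<le> 2 * (1 + (norm \<xi>)\<^sup>2) * (min 1 ((norm x)\<^sup>2) * \<nu> x)" for x
    proof -
      have "1 - cos (\<xi> \<bullet> x) \<le> 2 * (1 + (norm \<xi>)\<^sup>2) * min 1 ((norm x)\<^sup>2)"
      proof (cases "norm x \<le> 1")
        case True
        have "1 - cos (\<xi> \<bullet> x) = 2 * (sin ((\<xi> \<bullet> x) / 2))\<^sup>2"
          using cos_double_sin[of "(\<xi> \<bullet> x) / 2"] by simp
        also have "\<dots> \<le> 2 * ((\<xi> \<bullet> x) / 2)\<^sup>2"
          by (intro mult_left_mono abs_le_square_iff[THEN iffD1] abs_sin_x_le_abs_x) auto
        also have "\<dots> \<le> 2 * (norm \<xi> * norm x)\<^sup>2"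
        proof -
          have "\<bar>\<xi> \<bullet> x\<bar> \<le> norm \<xi> * norm x" by (rule Cauchy_Schwarz_ineq2)
          then have "(\<xi> \<bullet> x)\<^sup>2 \<le> (norm \<xi> * norm x)\<^sup>2" by (simp add: abs_le_square_iff[symmetric])
          moreover have "((\<xi> \<bullet> x) / 2)\<^sup>2 \<le> (\<xi> \<bullet> x)\<^sup>2" by (simp add: power_divide)
          ultimately show ?thesis by linarith
        qed
        also have "\<dots> \<le> 2 * (1 + (norm \<xi>)\<^sup>2) * (norm x)\<^sup>2"
          by (simp add: power_mult_distrib algebra_simps)
        also have "(norm x)\<^sup>2 = min 1 ((norm x)\<^sup>2)"
          using power_le_one[of "norm x" 2] True by simp
        finally show ?thesis .
      next
        case False
        then have "min 1 ((norm x)\<^sup>2) = 1" by (simp add: min_def)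
        moreover have "1 - cos (\<xi> \<bullet> x) \<le> 2" using cos_ge_minus_one[of "\<xi> \<bullet> x"] by linarith
        ultimately show ?thesis using zero_le_power2[of "norm \<xi>"] by (simp add: add_increasing2)
      qed
      from mult_right_mono[OF this nn[of x]] show ?thesis by (simp add: mult_ac)
    qed
    then have "levy_exponent \<nu> \<xi> \<le> (\<integral>x. 2 * (1 + (norm \<xi>)\<^sup>2) * (min 1 ((norm x)\<^sup>2) * \<nu> x) \<partial>lborel)"
      unfolding levy_exponent_def using int nn
      by (intro integral_mono') auto
    also have "\<dots> = 2 * (1 + (norm \<xi>)\<^sup>2) * (\<integral>x. min 1 ((norm x)\<^sup>2) * \<nu> x \<partial>lborel)"
      by (rule integral_mult_right_zero)
    finally show ?thesis by (simp only: mult_ac)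
  qed
qed

section \<open>Asymptotic equivalence and annuli\<close>

lemma slowly_varying_eventually_pos:
  assumes "slowly_varying_infty l" shows "eventually (\<lambda>x. 0 < l x) at_top"
  using assms by (auto simp: slowly_varying_infty_def eventually_at_top_linorder)

lemma eventually_at_top_scale:
  fixes c :: real
  assumes "eventually P at_top" "c > 0"
  shows "eventually (\<lambda>x. P (c * x)) at_top"
  using eventually_compose_filterlim[OF assms(1)
      filterlim_tendsto_pos_mult_at_top[OF tendsto_const assms(2) filterlim_ident]] .

lemma asymptotic_eventually_pos:
  fixes l m :: "real \<Rightarrow> real"
  assumes "slowly_varying_infty l" and lim: "((\<lambda>x. m x / l x) \<longlongrightarrow> 1) at_top"
  shows "eventually (\<lambda>x. 0 < l x \<and> 0 < m x \<and> m x < 2 * l x) at_top"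
proof -
  have "eventually (\<lambda>x. m x / l x > 0) at_top" "eventually (\<lambda>x. m x / l x < 2) at_top"
    using order_tendstoD[OF lim, of 0] order_tendstoD[OF lim, of 2] by auto
  with slowly_varying_eventually_pos[OF assms(1)] show ?thesis
    by eventually_elim (auto simp: zero_less_divide_iff divide_less_eq)
qed

text \<open>This lemma and the next two prepare the exchange of \<open>l\<close> for the increment
  \<psi>(e s) - \<psi>(s), which is asymptotic to \<open>l\<close> because ln e = 1: all that is
  assumed of \<open>l\<close> near infinity survives the exchange.\<close>

lemma slowly_varying_asymptotic:
  fixes l m :: "real \<Rightarrow> real"
  assumes sv: "slowly_varying_infty l" and lim: "((\<lambda>x. m x / l x) \<longlongrightarrow> 1) at_top"
  shows "slowly_varying_infty m"
  unfolding slowly_varying_infty_def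
proof (intro conjI allI impI)
  note pos = asymptotic_eventually_pos[OF sv lim]
  show "\<exists>a. \<forall>x\<ge>a. 0 < m x" using pos by (auto simp: eventually_at_top_linorder)
  fix c :: real assume c: "c > 0"
  have "filterlim (\<lambda>x. c * x) at_top at_top"
    using filterlim_tendsto_pos_mult_at_top[OF tendsto_const c filterlim_ident] .
  then have "((\<lambda>x. m (c * x) / l (c * x)) \<longlongrightarrow> 1) at_top" by (rule filterlim_compose[OF lim])
  moreover have "((\<lambda>x. l (c * x) / l x) \<longlongrightarrow> 1) at_top" using sv c by (auto simp: slowly_varying_infty_def)
  ultimately have "((\<lambda>x. m (c * x) / l (c * x) * (l (c * x) / l x) / (m x / l x)) \<longlongrightarrow> 1 * 1 / 1) at_top"
    using lim by (intro tendsto_mult tendsto_divide) auto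
  then have "((\<lambda>x. m (c * x) / l (c * x) * (l (c * x) / l x) / (m x / l x)) \<longlongrightarrow> 1) at_top" by simp
  then show "((\<lambda>x. m (c * x) / m x) \<longlongrightarrow> 1) at_top"
  proof (rule Lim_transform_eventually)
    show "eventually (\<lambda>x. m (c * x) / l (c * x) * (l (c * x) / l x) / (m x / l x) = m (c * x) / m x) at_top"
      using pos eventually_at_top_scale[OF pos c] by eventually_elim auto
  qed
qed

lemma de_haan_asymptotic:
  fixes l m :: "real \<Rightarrow> real"
  assumes Pi: "de_haan_class l \<psi>" and sv: "slowly_varying_infty l"
    and lim: "((\<lambda>x. m x / l x) \<longlongrightarrow> 1) at_top"
  shows "de_haan_class m \<psi>"
  unfolding de_haan_class_def
proof (intro conjI allI impI)
  note pos = asymptotic_eventually_pos[OF sv lim]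
  show "\<exists>a. \<forall>x\<ge>a. 0 \<le> \<psi> x" using Pi by (auto simp: de_haan_class_def)
  fix c :: real assume c: "c > 0"
  have "((\<lambda>x. (\<psi> (c * x) - \<psi> x) / l x) \<longlongrightarrow> ln c) at_top" using Pi c by (auto simp: de_haan_class_def)
  then have "((\<lambda>x. (\<psi> (c * x) - \<psi> x) / l x / (m x / l x)) \<longlongrightarrow> ln c / 1) at_top"
    using lim by (intro tendsto_divide) auto
  then have "((\<lambda>x. (\<psi> (c * x) - \<psi> x) / l x / (m x / l x)) \<longlongrightarrow> ln c) at_top" by simp
  then show "((\<lambda>x. (\<psi> (c * x) - \<psi> x) / m x) \<longlongrightarrow> ln c) at_top"
  proof (rule Lim_transform_eventually)
    show "eventually (\<lambda>x. (\<psi> (c * x) - \<psi> x) / l x / (m x / l x) = (\<psi> (c * x) - \<psi> x) / m x) at_top"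
      using pos by eventually_elim auto
  qed
qed

lemma bounded_asymptotic:
  fixes l m :: "real \<Rightarrow> real"
  assumes sv: "slowly_varying_infty l" and lim: "((\<lambda>x. m x / l x) \<longlongrightarrow> 1) at_top"
    and bdd: "\<exists>B a. \<forall>x\<ge>a. \<bar>l x\<bar> \<le> B"
  shows "\<exists>B a. \<forall>x\<ge>a. \<bar>m x\<bar> \<le> B"
proof -
  obtain B a where B: "\<And>x. x \<ge> a \<Longrightarrow> \<bar>l x\<bar> \<le> B" using bdd by auto
  have "eventually (\<lambda>x. \<bar>m x\<bar> \<le> 2 * B) at_top"
    using asymptotic_eventually_pos[OF sv lim] eventually_ge_at_top[of a]
    by eventually_elim (use B in force)
  then show ?thesis by (auto simp: eventually_at_top_linorder)
qed

text \<open>\<open>ln b\<close> is the limiting mass of an annulus with ratio of radii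
  \<open>b\<close>, and \<open>b ^ d - 1\<close> its normalised volume; the limit is the quotient of
  their derivatives at 1. It is two-sided because annuli on both sides of the sphere are
  needed.\<close>

lemma ln_over_power_minus_one_tendsto:
  assumes "d > 0"
  shows "((\<lambda>b::real. ln b / (b ^ d - 1)) \<longlongrightarrow> 1 / real d) (at 1)"
proof -
  have "(ln has_real_derivative 1) (at (1::real))" by (auto intro!: derivative_eq_intros)
  then have 1: "((\<lambda>b::real. (ln b - ln 1) / (b - 1)) \<longlongrightarrow> 1) (at 1)"
    by (simp add: has_field_derivative_iff)
  have "((\<lambda>b. b ^ d) has_real_derivative real d) (at (1::real))" by (auto intro!: derivative_eq_intros)
  then have 2: "((\<lambda>b::real. (b ^ d - 1 ^ d) / (b - 1)) \<longlongrightarrow> real d) (at 1)"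
    by (simp add: has_field_derivative_iff)
  have "((\<lambda>b::real. ((ln b - ln 1) / (b - 1)) / ((b ^ d - 1 ^ d) / (b - 1))) \<longlongrightarrow> 1 / real d) (at 1)"
    using assms by (intro tendsto_divide 1 2) auto
  then show ?thesis
    by (rule Lim_transform_eventually) (auto simp: eventually_at_filter)
qed

lemma measure_annulus:
  fixes a b :: real
  assumes "0 \<le> a" "a \<le> b"
  shows "measure lborel {z::'a::euclidean_space. a < norm z \<and> norm z \<le> b} = unit_ball_vol (real DIM('a)) * (b ^ DIM('a) - a ^ DIM('a))"
    and "emeasure lborel {z::'a. a < norm z \<and> norm z \<le> b} < \<infinity>"
proof -
  have eq: "{z::'a. a < norm z \<and> norm z \<le> b} = cball 0 b - cball 0 a" by auto
  have fin: "emeasure lborel (cball 0 b :: 'a set) < \<infinity>" by (rule emeasure_lborel_cball_finite)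
  have "measure lborel (cball 0 b - cball 0 a :: 'a set) = measure lborel (cball 0 b :: 'a set) - measure lborel (cball 0 a :: 'a set)"
    using assms fin by (intro measure_Diff) auto
  then show "measure lborel {z::'a. a < norm z \<and> norm z \<le> b} = unit_ball_vol (real DIM('a)) * (b ^ DIM('a) - a ^ DIM('a))"
    using assms by (simp add: eq content_cball algebra_simps)
  show "emeasure lborel {z::'a. a < norm z \<and> norm z \<le> b} < \<infinity>"
    unfolding eq using fin by (rule le_less_trans[rotated]) (auto intro!: emeasure_mono)
qed

lemma annulus_mass_bounds:
  fixes f :: "'a::euclidean_space \<Rightarrow> real" and P :: "'a measure" and a b c :: real
  assumes P: "prob_space P" and ab: "0 \<le> a" "a \<le> b"
    and mass: "emeasure P {z. a < norm z \<and> norm z \<le> b} = (\<integral>\<^sup>+ z\<in>{z. a < norm z \<and> norm z \<le> b}. ennreal (f z) \<partial>lborel)"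
    and c: "c \<ge> 0"
  shows "(\<And>z. a < norm z \<Longrightarrow> norm z \<le> b \<Longrightarrow> c \<le> f z) \<Longrightarrow>
      c * (unit_ball_vol (real DIM('a)) * (b ^ DIM('a) - a ^ DIM('a))) \<le> measure P {z. a < norm z \<and> norm z \<le> b}"
    and "(\<And>z. a < norm z \<Longrightarrow> norm z \<le> b \<Longrightarrow> f z \<le> c) \<Longrightarrow>
      measure P {z. a < norm z \<and> norm z \<le> b} \<le> c * (unit_ball_vol (real DIM('a)) * (b ^ DIM('a) - a ^ DIM('a)))"
proof -
  interpret prob_space P by fact
  let ?S = "{z::'a. a < norm z \<and> norm z \<le> b}"
  have S: "emeasure lborel ?S = ennreal (unit_ball_vol (real DIM('a)) * (b ^ DIM('a) - a ^ DIM('a)))"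
    using measure_annulus[OF ab, where ?'a='a] by (simp add: emeasure_eq_ennreal_measure less_top)
  have nn: "0 \<le> unit_ball_vol (real DIM('a)) * (b ^ DIM('a) - a ^ DIM('a))"
    using ab by (intro mult_nonneg_nonneg) (auto intro!: power_mono)
  have cS: "(\<integral>\<^sup>+ z\<in>?S. ennreal c \<partial>lborel) = ennreal (c * (unit_ball_vol (real DIM('a)) * (b ^ DIM('a) - a ^ DIM('a))))"
    using c nn by (subst nn_integral_cmult_indicator) (auto simp: S ennreal_mult)
  show "c * (unit_ball_vol (real DIM('a)) * (b ^ DIM('a) - a ^ DIM('a))) \<le> measure P ?S"
    if "\<And>z. a < norm z \<Longrightarrow> norm z \<le> b \<Longrightarrow> c \<le> f z"
  proof -
    have "(\<integral>\<^sup>+ z\<in>?S. ennreal c \<partial>lborel) \<le> (\<integral>\<^sup>+ z\<in>?S. ennreal (f z) \<partial>lborel)"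
      using that by (intro nn_integral_mono) (auto simp: indicator_def intro!: ennreal_leI)
    then show ?thesis unfolding cS mass[symmetric] by (simp add: emeasure_eq_measure)
  qed
  show "measure P ?S \<le> c * (unit_ball_vol (real DIM('a)) * (b ^ DIM('a) - a ^ DIM('a)))"
    if "\<And>z. a < norm z \<Longrightarrow> norm z \<le> b \<Longrightarrow> f z \<le> c"
  proof -
    have "(\<integral>\<^sup>+ z\<in>?S. ennreal (f z) \<partial>lborel) \<le> (\<integral>\<^sup>+ z\<in>?S. ennreal c \<partial>lborel)"
      using that by (intro nn_integral_mono) (auto simp: indicator_def intro!: ennreal_leI)
    then show ?thesis unfolding cS mass[symmetric] using c nn by (simp add: emeasure_eq_measure)
  qed
qed

section \<open>Increments of the exponent\<close>

lemma exp_minus_one_quotient_tendsto: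
  fixes a \<tau> :: "'i \<Rightarrow> real"
  assumes "((\<lambda>n. a n / \<tau> n) \<longlongrightarrow> A) F" "(\<tau> \<longlongrightarrow> 0) F" "eventually (\<lambda>n. \<tau> n \<noteq> 0) F"
  shows "((\<lambda>n. (exp (a n) - 1) / \<tau> n) \<longlongrightarrow> A) F"
proof -
  \<comment> \<open>\<open>E\<close> fills the removable singularity at 0, so indices with
    \<open>a n = 0\<close> need no separate treatment.\<close>
  define E where "E h = (if h = 0 then 1 else (exp h - 1) / h)" for h :: real
  have E: "isCont E 0"
  proof -
    have "((\<lambda>h::real. (exp h - 1) / h) \<longlongrightarrow> 1) (at 0)" by (rule lim_exp_minus_1)
    then have "(E \<longlongrightarrow> 1) (at 0)"
      by (rule Lim_transform_eventually) (auto simp: E_def eventually_at_filter)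
    then show ?thesis by (simp add: isCont_def E_def)
  qed
  have "((\<lambda>n. (a n / \<tau> n) * \<tau> n) \<longlongrightarrow> A * 0) F" using assms by (intro tendsto_mult)
  then have "((\<lambda>n. (a n / \<tau> n) * \<tau> n) \<longlongrightarrow> 0) F" by simp
  then have "(a \<longlongrightarrow> 0) F"
    by (rule Lim_transform_eventually) (use assms(3) in \<open>auto elim: eventually_mono\<close>)
  then have "((\<lambda>n. E (a n)) \<longlongrightarrow> E 0) F" by (rule isCont_tendsto_compose[OF E])
  then have "((\<lambda>n. E (a n) * (a n / \<tau> n)) \<longlongrightarrow> E 0 * A) F" using assms by (intro tendsto_mult)
  moreover have "(\<lambda>n. E (a n) * (a n / \<tau> n)) = (\<lambda>n. (exp (a n) - 1) / \<tau> n)"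
    by (auto simp: E_def)
  moreover have "E 0 * A = A" by (simp add: E_def)
  ultimately show ?thesis by simp
qed

lemma abs_exp_diff_le:
  fixes a b :: real
  shows "\<bar>exp a - exp b\<bar> \<le> \<bar>a - b\<bar> * (exp a + exp b)"
proof -
  have *: "exp a - exp b \<le> (a - b) * exp a" for a b :: real
  proof -
    have "1 + (b - a) \<le> exp (b - a)" by (rule exp_ge_add_one_self)
    from mult_right_mono[OF this, of "exp a"] show ?thesis
      by (simp add: algebra_simps exp_diff)
  qed
  have le: "exp a - exp b \<le> \<bar>a - b\<bar> * (exp a + exp b)" for a b :: real
  proof -
    have "(a - b) * exp a \<le> \<bar>a - b\<bar> * (exp a + exp b)" by (intro mult_mono) auto
    with *[of a b] show ?thesis by linarith
  qed
  show ?thesis using le[of a b] le[of b a] by (auto simp: abs_if algebra_simps)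
qed

lemma exp_half_abs_ln_le:
  fixes k :: real assumes "k > 0"
  shows "exp (\<bar>ln k\<bar> / 2) \<le> k powr (1/2) + k powr (-1/2)"
  using assms by (cases "ln k \<ge> 0") (auto simp: powr_def)

text \<open>The exponent divided by \<open>t l\<close> converges by the de Haan condition.
  Boundedness of \<open>l\<close> gives \<open>t l \<longrightarrow> 0\<close>, hence the exponent
  itself vanishes in the limit and \<open>exp h - 1\<close> may be replaced by
  \<open>h\<close>.\<close>

lemma exponent_increment_tendsto:
  fixes \<psi> l :: "real \<Rightarrow> real" and t x :: "nat \<Rightarrow> real"
  assumes sv: "slowly_varying_infty l" and lbd: "\<exists>B a. \<forall>x\<ge>a. \<bar>l x\<bar> \<le> B"
    and Pi: "de_haan_class l \<psi>"
    and t: "\<And>n. t n > 0" "t \<longlonglongrightarrow> 0" and x: "filterlim x at_top sequentially"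
    and c: "c > 0"
  shows "(\<lambda>n. (exp (- (t n * (\<psi> (c * x n) - \<psi> (x n)))) - 1) / (t n * l (x n))) \<longlonglongrightarrow> - ln c"
proof (rule exp_minus_one_quotient_tendsto)
  obtain a where a: "\<And>y. y \<ge> a \<Longrightarrow> 0 < l y" using sv by (auto simp: slowly_varying_infty_def)
  obtain B b where B: "\<And>y. y \<ge> b \<Longrightarrow> \<bar>l y\<bar> \<le> B" using lbd by auto
  have ev: "eventually (\<lambda>n. x n \<ge> max a b) sequentially"
    using x unfolding filterlim_at_top by blast
  show "eventually (\<lambda>n. t n * l (x n) \<noteq> 0) sequentially"
    using ev by eventually_elim (use a t(1) in \<open>force simp: less_le\<close>)
  have "(\<lambda>n. (\<psi> (c * x n) - \<psi> (x n)) / l (x n)) \<longlonglongrightarrow> ln c"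
    using Pi c filterlim_compose[OF _ x] by (auto simp: de_haan_class_def)
  then have "(\<lambda>n. - ((\<psi> (c * x n) - \<psi> (x n)) / l (x n))) \<longlonglongrightarrow> - ln c" by (rule tendsto_minus)
  moreover have "- (t n * (\<psi> (c * x n) - \<psi> (x n))) / (t n * l (x n))
      = - ((\<psi> (c * x n) - \<psi> (x n)) / l (x n))" for n
    using t(1)[of n] by simp
  ultimately show "(\<lambda>n. - (t n * (\<psi> (c * x n) - \<psi> (x n))) / (t n * l (x n))) \<longlonglongrightarrow> - ln c"
    by simp
  show "(\<lambda>n. t n * l (x n)) \<longlonglongrightarrow> 0"
  proof (rule Lim_null_comparison)
    show "eventually (\<lambda>n. norm (t n * l (x n)) \<le> t n * B) sequentially"
      using ev by eventually_elim (use B t(1) in \<open>auto simp: abs_mult less_imp_le\<close>)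
    show "(\<lambda>n. t n * B) \<longlonglongrightarrow> 0" using tendsto_mult_right[OF t(2), of B] by simp
  qed
qed

text \<open>Two regimes. If \<open>x n * k\<close> is large, all arguments lie where the increments
  of \<psi> and of \<open>ln l\<close> are controlled. Otherwise the numerator is bounded by 1 and
  \<open>k\<close> is so small that its negative powers absorb the whole denominator. The exponents
  of \<open>k\<close> collected are at most 1/4 in the first case and 3/8 in the second, within the
  1/2 allowed.\<close>

lemma exponent_increment_bound:
  fixes \<psi> l :: "real \<Rightarrow> real" and t x :: "nat \<Rightarrow> real"
  assumes \<psi>_nonneg: "\<And>s. s \<ge> 0 \<Longrightarrow> 0 \<le> \<psi> s"
    and \<psi>_meas: "(\<lambda>s. \<psi> \<bar>s\<bar>) \<in> borel_measurable borel"
    and l_meas: "(\<lambda>s. l \<bar>s\<bar>) \<in> borel_measurable borel"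
    and sv: "slowly_varying_infty l" and lbd: "\<exists>B a. \<forall>x\<ge>a. \<bar>l x\<bar> \<le> B"
    and Pi: "de_haan_class l \<psi>"
    and t: "\<And>n. t n > 0" "t \<longlonglongrightarrow> 0" and x: "filterlim x at_top sequentially"
    and t\<psi>: "filterlim (\<lambda>n. t n * \<psi> (x n)) at_top sequentially"
    and c: "c > 0"
  obtains C where "eventually (\<lambda>n. \<forall>k>0. \<bar>exp (- (t n * \<psi> (c * x n * k))) - exp (- (t n * \<psi> (x n * k)))\<bar>
        / (t n * l (x n) * exp (- (t n * \<psi> (x n)))) \<le> C * (k powr (1/2) + k powr (-1/2))) sequentially"
proof -
  obtain a where a: "\<And>y. y \<ge> a \<Longrightarrow> 0 < l y" using sv by (auto simp: slowly_varying_infty_def)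
  obtain B b where B: "\<And>y. y \<ge> b \<Longrightarrow> \<bar>l y\<bar> \<le> B" using lbd by auto
  have B0: "B \<ge> 0" using B[of b] by auto
  have haan: "((\<lambda>x. (\<psi> (c * x) - \<psi> x) / l x) \<longlongrightarrow> ln c) at_top" if "c > 0" for c
    using Pi that by (auto simp: de_haan_class_def)
  have incr: "eventually (\<lambda>y. \<bar>\<psi> (c * y) - \<psi> y\<bar> \<le> (\<bar>ln c\<bar> + 1) * l y) at_top" if c: "c > 0" for c
  proof -
    have "eventually (\<lambda>y. \<bar>(\<psi> (c * y) - \<psi> y) / l y\<bar> < \<bar>ln c\<bar> + 1) at_top"
      using tendsto_rabs[OF haan[OF c]] by (rule order_tendstoD) simp
    then show ?thesis using eventually_ge_at_top[of a]
    proof eventually_elim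
      case (elim y) then show ?case using a[of y] by (simp add: abs_div divide_less_eq)
    qed
  qed
  \<comment> \<open>The constant 3 bounds \<open>\<bar>ln c\<bar> + 1\<close> for \<open>c\<close>
    in [1, e^2], and \<open>B\<close> bounds \<open>l\<close>.\<close>
  have "\<exists>x1>0. \<forall>x\<ge>x1. \<forall>y\<ge>x1. \<bar>\<psi> y - \<psi> x\<bar> \<le> 2 * (3 * B) * (1 + \<bar>ln y - ln x\<bar>)"
  proof (rule logarithmically_bounded_increments)
    have "(\<lambda>v. \<psi> \<bar>exp v\<bar>) \<in> borel_measurable borel"
      using measurable_compose[OF borel_measurable_exp \<psi>_meas] by simp
    then show "(\<lambda>v. \<psi> (exp v)) \<in> borel_measurable borel" by simp
    fix c :: real assume c: "1 \<le> c" "c \<le> exp 2"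
    then have cpos: "c > 0" by simp
    have lc: "\<bar>ln c\<bar> \<le> 2" using c ln_le_cancel_iff[of c "exp 2"] by simp
    show "eventually (\<lambda>x. \<bar>\<psi> (c * x) - \<psi> x\<bar> \<le> 3 * B) at_top"
      using incr[OF cpos] eventually_ge_at_top[of a] eventually_ge_at_top[of b]
    proof eventually_elim
      case (elim y)
      have "(\<bar>ln c\<bar> + 1) * l y \<le> 3 * B" using lc a[of y] B[of y] elim by (intro mult_mono) auto
      then show ?case using elim c by linarith
    qed
  qed
  then obtain x1 where x1: "x1 > 0" "\<And>x y. x \<ge> x1 \<Longrightarrow> y \<ge> x1 \<Longrightarrow>
      \<bar>\<psi> y - \<psi> x\<bar> \<le> 2 * (3 * B) * (1 + \<bar>ln y - ln x\<bar>)" by blast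
  \<comment> \<open>The tolerance 1/16 yields the Potter exponent 1/8. It may be any positive
    number, because \<open>ln (l (c * x) / l x)\<close> tends to 0.\<close>
  have "\<exists>x2>0. \<forall>x\<ge>x2. \<forall>y\<ge>x2. \<bar>ln (l y) - ln (l x)\<bar> \<le> 2 * (1/16) * (1 + \<bar>ln y - ln x\<bar>)"
  proof (rule logarithmically_bounded_increments)
    have "(\<lambda>v. ln (l \<bar>exp v\<bar>)) \<in> borel_measurable borel"
      using borel_measurable_ln[OF measurable_compose[OF borel_measurable_exp l_meas]] by simp
    then show "(\<lambda>v. ln (l (exp v))) \<in> borel_measurable borel" by simp
    fix c :: real assume c: "1 \<le> c" "c \<le> exp 2"
    have "((\<lambda>x. l (c * x) / l x) \<longlongrightarrow> 1) at_top"
      using sv c by (auto simp: slowly_varying_infty_def)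
    then have "((\<lambda>x. ln (l (c * x) / l x)) \<longlongrightarrow> ln 1) at_top" by (rule tendsto_ln) simp
    then have "((\<lambda>x. \<bar>ln (l (c * x) / l x)\<bar>) \<longlongrightarrow> 0) at_top" using tendsto_rabs by fastforce
    then have "eventually (\<lambda>x. \<bar>ln (l (c * x) / l x)\<bar> < 1/16) at_top"
      by (rule order_tendstoD) simp
    then show "eventually (\<lambda>x. \<bar>ln (l (c * x)) - ln (l x)\<bar> \<le> 1/16) at_top"
      using eventually_ge_at_top[of a] eventually_ge_at_top[of 0]
    proof eventually_elim
      case (elim y)
      have "y \<le> c * y" using c elim by (simp add: mult_le_cancel_right1)
      then have "l (c * y) > 0" "l y > 0" using a elim by auto
      then show ?case using elim by (simp add: ln_div)
    qed
  qed
  then obtain x2 where x2: "x2 > 0" "\<And>x y. x \<ge> x2 \<Longrightarrow> y \<ge> x2 \<Longrightarrow>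
      \<bar>ln (l y) - ln (l x)\<bar> \<le> 2 * (1/16) * (1 + \<bar>ln y - ln x\<bar>)" by blast
  obtain x4 where x4: "\<And>y. y \<ge> x4 \<Longrightarrow> \<bar>\<psi> (c * y) - \<psi> y\<bar> \<le> (\<bar>ln c\<bar> + 1) * l y"
    using incr[OF c] by (auto simp: eventually_at_top_linorder)
  \<comment> \<open>Beyond \<open>Y\<close> all estimates hold. \<open>Z\<close> is chosen so that
    \<open>u * k \<ge> Z\<close> puts both \<open>u * k\<close> and \<open>c * u * k\<close> beyond
    \<open>Y\<close>, also when \<open>c < 1\<close>.\<close>
  define Y where "Y = Max {x1, x2, a, x4}"
  define Z where "Z = max Y (Y / c)"
  have Y: "Y \<ge> x1" "Y \<ge> x2" "Y \<ge> a" "Y \<ge> x4" by (auto simp: Y_def)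
  have ZY: "Z \<ge> Y" "c * Z \<ge> Y" using c by (auto simp: Z_def max_def field_simps)
  have Z0: "Z > 0" using ZY Y x1 by linarith
  \<comment> \<open>\<open>C2\<close> serves twice:
    \<open>\<psi> u \<le> C2 * (1 + ln u - ln Z)\<close> for \<open>u \<ge> Z\<close>, and
    \<open>6 * B \<le> C2\<close>. Thus the single condition \<open>t n * C2 < 1/8\<close> turns
    logarithmic bounds for \<psi> into powers with exponent 1/8 in both regimes.\<close>
  define C2 where "C2 = \<psi> Z + 6 * B"
  have C2: "C2 \<ge> 0" "6 * B \<le> C2" using \<psi>_nonneg[of Z] Z0 B0 by (auto simp: C2_def)
  define K1 where "K1 = 2 * (\<bar>ln c\<bar> + 1) * exp (1 + \<bar>ln c\<bar>)"
  define K2 where "K2 = 8 * C2 * (exp 1 / l Z)"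
  have lZ: "l Z > 0" using a ZY Y by simp
  have K0: "K1 \<ge> 0" "K2 \<ge> 0" using C2 lZ by (auto simp: K1_def K2_def)
  have "(\<lambda>n. t n * C2) \<longlonglongrightarrow> 0" using tendsto_mult_right[OF t(2), of C2] by simp
  then have ev1: "eventually (\<lambda>n. t n * C2 < 1/8) sequentially" by (rule order_tendstoD) simp
  have ev2: "eventually (\<lambda>n. x n \<ge> Z) sequentially" using x by (auto simp: filterlim_at_top)
  have ev3: "eventually (\<lambda>n. t n * \<psi> (x n) \<ge> 1) sequentially" using t\<psi> by (auto simp: filterlim_at_top)
  show thesis
  proof (rule that[of "K1 + K2"])
    show "eventually (\<lambda>n. \<forall>k>0. \<bar>exp (- (t n * \<psi> (c * x n * k))) - exp (- (t n * \<psi> (x n * k)))\<bar>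
        / (t n * l (x n) * exp (- (t n * \<psi> (x n)))) \<le> (K1 + K2) * (k powr (1/2) + k powr (-1/2))) sequentially"
      using ev1 ev2 ev3
    proof eventually_elim
      case (elim n)
      define T u where "T = t n" and "u = x n"
      have T: "T > 0" "T * C2 \<le> 1/8" "T * \<psi> u \<ge> 1" and u: "u \<ge> Z" using elim t by (auto simp: T_def u_def)
      have u0: "u > 0" using u Z0 by simp
      have lu: "l u > 0" using a u ZY Y by simp
      have T6: "T * (6 * B) \<le> 1/8" using mult_left_mono[OF C2(2), of T] T by linarith
      have bound: "\<bar>exp (- (T * \<psi> (c * u * k))) - exp (- (T * \<psi> (u * k)))\<bar>
        / (T * l u * exp (- (T * \<psi> u))) \<le> (K1 + K2) * exp (\<bar>ln k\<bar> / 2)" (is "?Q \<le> _") if k: "k > 0" for k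
      proof (cases "u * k \<ge> Z")
        case True
        have ge: "u \<ge> Y" "u * k \<ge> Y" "c * u * k \<ge> Y"
        proof -
          show "u \<ge> Y" "u * k \<ge> Y" using u True ZY by auto
          have "c * (u * k) \<ge> c * Z" using True c by (intro mult_left_mono) auto
          then show "c * u * k \<ge> Y" using ZY by (simp add: mult_ac)
        qed
        have tk: "exp (- (T * (\<psi> y - \<psi> u))) \<le> exp ((1 + \<bar>ln k\<bar> + \<bar>ln c\<bar>) / 8)"
          if y: "y \<ge> Y" "\<bar>ln y - ln u\<bar> \<le> \<bar>ln k\<bar> + \<bar>ln c\<bar>" for y
        proof -
          have "\<bar>\<psi> y - \<psi> u\<bar> \<le> 2 * (3 * B) * (1 + \<bar>ln y - ln u\<bar>)" using x1 y Y ge by auto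
          also have "\<dots> \<le> 2 * (3 * B) * (1 + (\<bar>ln k\<bar> + \<bar>ln c\<bar>))"
            using y B0 by (intro mult_left_mono add_left_mono) auto
          finally have "\<psi> u - \<psi> y \<le> 6 * B * (1 + \<bar>ln k\<bar> + \<bar>ln c\<bar>)" by (simp add: add_ac)
          then have "T * (\<psi> u - \<psi> y) \<le> T * (6 * B * (1 + \<bar>ln k\<bar> + \<bar>ln c\<bar>))"
            using T by (intro mult_left_mono) auto
          also have "\<dots> = T * (6 * B) * (1 + \<bar>ln k\<bar> + \<bar>ln c\<bar>)" by simp
          also have "\<dots> \<le> 1/8 * (1 + \<bar>ln k\<bar> + \<bar>ln c\<bar>)" using T6 by (intro mult_right_mono) auto
          finally have "T * (\<psi> u - \<psi> y) \<le> (1 + \<bar>ln k\<bar> + \<bar>ln c\<bar>) / 8" by simp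
          moreover have "- (T * (\<psi> y - \<psi> u)) = T * (\<psi> u - \<psi> y)" by (simp add: algebra_simps)
          ultimately show ?thesis by simp
        qed
        have e1: "exp (- (T * (\<psi> (u * k) - \<psi> u))) \<le> exp ((1 + \<bar>ln k\<bar> + \<bar>ln c\<bar>) / 8)"
          using ge u0 k by (intro tk) (auto simp: ln_mult)
        have e2: "exp (- (T * (\<psi> (c * u * k) - \<psi> u))) \<le> exp ((1 + \<bar>ln k\<bar> + \<bar>ln c\<bar>) / 8)"
          using ge u0 k c by (intro tk) (auto simp: ln_mult)
        have l1: "l (u * k) / l u \<le> exp ((1 + \<bar>ln k\<bar>) / 8)"
        proof -
          have p: "l (u * k) > 0" using a ge Y by auto
          have "\<bar>ln (l (u * k)) - ln (l u)\<bar> \<le> 2 * (1/16) * (1 + \<bar>ln (u * k) - ln u\<bar>)"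
            using x2 ge Y by auto
          then have "ln (l (u * k) / l u) \<le> (1 + \<bar>ln k\<bar>) / 8"
            using p lu u0 k abs_ge_self[of "ln (l (u * k)) - ln (l u)"]
            by (simp add: ln_div ln_mult del: abs_ge_self)
          then show ?thesis using p lu by (metis divide_pos_pos exp_le_cancel_iff exp_ln)
        qed
        \<comment> \<open>Division by \<open>exp (- (T * \<psi> u))\<close> leaves increments of
          \<psi> from \<open>u\<close> in the exponents. The mean value bound then produces the
          factor \<open>T * l (u * k)\<close>, which cancels \<open>T * l u\<close> up to the Potter
          bound \<open>l1\<close>.\<close>
        have "\<bar>exp (- (T * \<psi> (c * u * k))) - exp (- (T * \<psi> (u * k)))\<bar> / exp (- (T * \<psi> u)) =
          \<bar>exp (- (T * (\<psi> (c * u * k) - \<psi> u))) - exp (- (T * (\<psi> (u * k) - \<psi> u)))\<bar>"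
        proof -
          have "exp (- (T * (\<psi> y - \<psi> u))) = exp (- (T * \<psi> y)) / exp (- (T * \<psi> u))" for y
            by (simp add: exp_diff[symmetric] algebra_simps)
          then show ?thesis by (simp add: diff_divide_distrib[symmetric] abs_divide)
        qed
        also have "\<dots> \<le> \<bar>- (T * (\<psi> (c * u * k) - \<psi> u)) - (- (T * (\<psi> (u * k) - \<psi> u)))\<bar> *
          (exp (- (T * (\<psi> (c * u * k) - \<psi> u))) + exp (- (T * (\<psi> (u * k) - \<psi> u))))"
          by (rule abs_exp_diff_le)
        also have "\<dots> \<le> T * ((\<bar>ln c\<bar> + 1) * l (u * k)) * (2 * exp ((1 + \<bar>ln k\<bar> + \<bar>ln c\<bar>) / 8))"
        proof (rule mult_mono)
          have "\<bar>- (T * (\<psi> (c * u * k) - \<psi> u)) - (- (T * (\<psi> (u * k) - \<psi> u)))\<bar>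
             = T * \<bar>\<psi> (c * (u * k)) - \<psi> (u * k)\<bar>"
          proof -
            have "- (T * (\<psi> (c * u * k) - \<psi> u)) - (- (T * (\<psi> (u * k) - \<psi> u)))
              = - (T * (\<psi> (c * (u * k)) - \<psi> (u * k)))" by (simp add: algebra_simps)
            then show ?thesis using T by (simp add: abs_mult)
          qed
          also have "\<dots> \<le> T * ((\<bar>ln c\<bar> + 1) * l (u * k))"
            using T x4[of "u * k"] ge Y by (intro mult_left_mono) auto
          finally show "\<bar>- (T * (\<psi> (c * u * k) - \<psi> u)) - (- (T * (\<psi> (u * k) - \<psi> u)))\<bar> \<le>
            T * ((\<bar>ln c\<bar> + 1) * l (u * k))" .
          then show "0 \<le> T * ((\<bar>ln c\<bar> + 1) * l (u * k))" by linarith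
          show "exp (- (T * (\<psi> (c * u * k) - \<psi> u))) + exp (- (T * (\<psi> (u * k) - \<psi> u)))
            \<le> 2 * exp ((1 + \<bar>ln k\<bar> + \<bar>ln c\<bar>) / 8)" using e1 e2 by linarith
        qed (simp add: add_nonneg_nonneg)
        finally have "?Q \<le> T * ((\<bar>ln c\<bar> + 1) * l (u * k)) * (2 * exp ((1 + \<bar>ln k\<bar> + \<bar>ln c\<bar>) / 8)) / (T * l u)"
          using T lu by (simp add: field_simps)
        also have "\<dots> = 2 * (\<bar>ln c\<bar> + 1) * ((l (u * k) / l u) * exp ((1 + \<bar>ln k\<bar> + \<bar>ln c\<bar>) / 8))"
          using T lu by (simp add: field_simps)
        also have "\<dots> \<le> 2 * (\<bar>ln c\<bar> + 1) * (exp ((1 + \<bar>ln k\<bar>) / 8) * exp ((1 + \<bar>ln k\<bar> + \<bar>ln c\<bar>) / 8))"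
          using l1 by (intro mult_left_mono mult_right_mono) auto
        also have "\<dots> \<le> 2 * (\<bar>ln c\<bar> + 1) * (exp (1 + \<bar>ln c\<bar>) * exp (\<bar>ln k\<bar> / 2))"
        proof (rule mult_left_mono)
          have "(1 + p) / 8 + (1 + p + q) / 8 \<le> 1 + q + p / 2" if "p \<ge> 0" "q \<ge> 0" for p q :: real
            using that by (simp add: field_simps)
          from this[of "\<bar>ln k\<bar>" "\<bar>ln c\<bar>"]
          have "(1 + \<bar>ln k\<bar>) / 8 + (1 + \<bar>ln k\<bar> + \<bar>ln c\<bar>) / 8 \<le> 1 + \<bar>ln c\<bar> + \<bar>ln k\<bar> / 2" by simp
          then show "exp ((1 + \<bar>ln k\<bar>) / 8) * exp ((1 + \<bar>ln k\<bar> + \<bar>ln c\<bar>) / 8)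
            \<le> exp (1 + \<bar>ln c\<bar>) * exp (\<bar>ln k\<bar> / 2)" by (simp only: exp_add[symmetric] exp_le_cancel_iff)
        qed simp
        also have "\<dots> = K1 * exp (\<bar>ln k\<bar> / 2)" by (simp add: K1_def)
        also have "\<dots> \<le> (K1 + K2) * exp (\<bar>ln k\<bar> / 2)" using K0 by (intro mult_right_mono) auto
        finally show ?thesis .
      next
        case False
        \<comment> \<open>\<open>v\<close> measures on the logarithmic scale how far
          \<open>u\<close> lies beyond the threshold. As \<open>u * k < Z\<close>, it is at most
          \<open>\<bar>ln k\<bar>\<close>, so every bound in terms of \<open>v\<close> becomes one
          in terms of \<open>k\<close>.\<close>
        define v where "v = ln u - ln Z"
        have v0: "v \<ge> 0" using u Z0 by (simp add: v_def)
        have vk: "v \<le> \<bar>ln k\<bar>"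
        proof -
          have "ln (u * k) \<le> ln Z" using False u0 k Z0 by (subst ln_le_cancel_iff) auto
          then show ?thesis using u0 k by (simp add: v_def ln_mult)
        qed
        have "\<bar>\<psi> u - \<psi> Z\<bar> \<le> 2 * (3 * B) * (1 + \<bar>ln u - ln Z\<bar>)" using u ZY Y by (intro x1(2)) auto
        then have "\<psi> u \<le> \<psi> Z + 6 * B * (1 + v)" using v0 by (simp add: v_def)
        also have "\<dots> \<le> C2 * (1 + v)" using \<psi>_nonneg[of Z] Z0 v0 by (simp add: C2_def algebra_simps)
        finally have \<psi>u: "\<psi> u \<le> C2 * (1 + v)" .
        have "1 + v / 8 \<le> exp (v / 8)" by (rule exp_ge_add_one_self)
        then have ev: "1 + v \<le> 8 * exp (v / 8)" by linarith
        \<comment> \<open>Here \<open>T * \<psi> u \<ge> 1\<close> enters: it gives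
          \<open>1 / T \<le> \<psi> u\<close>, which is linear in \<open>v\<close>;
          \<open>ev\<close> trades this for a small exponential.\<close>
        have 1: "1 / T \<le> 8 * C2 * exp (v / 8)"
        proof -
          from ev have "C2 * (1 + v) \<le> C2 * (8 * exp (v / 8))" using C2 by (intro mult_left_mono) auto
          moreover have "1 / T \<le> \<psi> u" using T by (simp add: field_simps)
          ultimately show ?thesis using \<psi>u by (simp add: mult_ac)
        qed
        have 2: "1 / l u \<le> exp ((1 + v) / 8) / l Z"
        proof -
          have "\<bar>ln (l u) - ln (l Z)\<bar> \<le> 2 * (1/16) * (1 + \<bar>ln u - ln Z\<bar>)" using u ZY Y by (intro x2(2)) auto
          then have "ln (l Z / l u) \<le> (1 + v) / 8"
            using v0 lu lZ abs_ge_minus_self[of "ln (l u) - ln (l Z)"]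
            by (simp add: v_def ln_div del: abs_ge_minus_self)
          then have "l Z / l u \<le> exp ((1 + v) / 8)" using lu lZ
            by (metis divide_pos_pos exp_le_cancel_iff exp_ln)
          then show ?thesis using lu lZ by (simp add: field_simps)
        qed
        have 3: "exp (T * \<psi> u) \<le> exp ((1 + v) / 8)"
        proof -
          have "T * \<psi> u \<le> T * (C2 * (1 + v))" using T \<psi>u by (intro mult_left_mono) auto
          also have "\<dots> = (T * C2) * (1 + v)" by simp
          also have "\<dots> \<le> 1/8 * (1 + v)" using T v0 by (intro mult_right_mono) auto
          finally show ?thesis by simp
        qed
        have "\<bar>exp (- (T * \<psi> (c * u * k))) - exp (- (T * \<psi> (u * k)))\<bar> \<le> 1"
        proof -
          have "exp (- (T * \<psi> (c * u * k))) \<le> 1" "exp (- (T * \<psi> (u * k))) \<le> 1"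
            using T \<psi>_nonneg[of "c * u * k"] \<psi>_nonneg[of "u * k"] u0 k c by auto
          moreover have "exp (- (T * \<psi> (c * u * k))) > 0" "exp (- (T * \<psi> (u * k))) > 0" by auto
          ultimately show ?thesis by linarith
        qed
        then have "?Q \<le> 1 / (T * l u * exp (- (T * \<psi> u)))"
          using T lu by (intro divide_right_mono) auto
        also have "\<dots> = (1 / T) * (1 / l u) * exp (T * \<psi> u)" by (simp add: exp_minus field_simps)
        also have "\<dots> \<le> (8 * C2 * exp (v / 8)) * (exp ((1 + v) / 8) / l Z) * exp ((1 + v) / 8)"
          using 1 2 3 C2 T lu lZ by (intro mult_mono) auto
        also have "\<dots> = 8 * C2 / l Z * (exp (v / 8 + (1 + v) / 8 + (1 + v) / 8))"
          unfolding exp_add by simp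
        also have "\<dots> \<le> 8 * C2 / l Z * exp (1 + \<bar>ln k\<bar> / 2)"
        proof (rule mult_left_mono)
          have "v / 8 + (1 + v) / 8 + (1 + v) / 8 \<le> 1 + \<bar>ln k\<bar> / 2"
            using v0 vk by (simp add: field_simps)
          then show "exp (v / 8 + (1 + v) / 8 + (1 + v) / 8) \<le> exp (1 + \<bar>ln k\<bar> / 2)"
            by (simp only: exp_le_cancel_iff)
        qed (use C2 lZ in auto)
        also have "\<dots> = K2 * exp (\<bar>ln k\<bar> / 2)" by (simp add: K2_def exp_add)
        also have "\<dots> \<le> (K1 + K2) * exp (\<bar>ln k\<bar> / 2)" using K0 by (intro mult_right_mono) auto
        finally show ?thesis .
      qed
      show ?case
      proof (intro allI impI)
        fix k :: real assume k: "k > 0"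
        have "(K1 + K2) * exp (\<bar>ln k\<bar> / 2) \<le> (K1 + K2) * (k powr (1/2) + k powr (-1/2))"
          using exp_half_abs_ln_le[OF k] K0 by (intro mult_left_mono) auto
        with bound[OF k] show "\<bar>exp (- (t n * \<psi> (c * x n * k))) - exp (- (t n * \<psi> (x n * k)))\<bar>
        / (t n * l (x n) * exp (- (t n * \<psi> (x n)))) \<le> (K1 + K2) * (k powr (1/2) + k powr (-1/2))"
          unfolding T_def u_def by linarith
      qed
    qed
  qed
qed

text \<open>For every fixed \<open>g \<noteq> 0\<close> the quotient tends to the same value
  \<open>- ln c\<close>, whatever the size of \<open>g\<close>; integration against a probability
  measure therefore leaves it unchanged.\<close>

lemma gaussian_mixture_increment_tendsto:
  fixes \<psi> l :: "real \<Rightarrow> real" and t x :: "nat \<Rightarrow> real" and \<gamma> :: "'a::euclidean_space measure"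
  assumes \<psi>_nonneg: "\<And>s. s \<ge> 0 \<Longrightarrow> 0 \<le> \<psi> s"
    and \<psi>_meas: "(\<lambda>s. \<psi> \<bar>s\<bar>) \<in> borel_measurable borel"
    and l_meas: "(\<lambda>s. l \<bar>s\<bar>) \<in> borel_measurable borel"
    and sv: "slowly_varying_infty l" and lbd: "\<exists>B a. \<forall>x\<ge>a. \<bar>l x\<bar> \<le> B"
    and Pi: "de_haan_class l \<psi>"
    and t: "\<And>n. t n > 0" "t \<longlonglongrightarrow> 0"
    and x: "\<And>n. x n > 0" "filterlim x at_top sequentially"
    and t\<psi>: "filterlim (\<lambda>n. t n * \<psi> (x n)) at_top sequentially"
    and c: "c > 0"
    and \<gamma>: "prob_space \<gamma>" "sets \<gamma> = sets borel"
      "integrable \<gamma> (\<lambda>g. norm g powr (1/2) + norm g powr (-1/2))" "AE g in \<gamma>. g \<noteq> 0"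
  shows "(\<lambda>n. ((\<integral>g. exp (- (t n * \<psi> (c * x n * norm g))) \<partial>\<gamma>) - (\<integral>g. exp (- (t n * \<psi> (x n * norm g))) \<partial>\<gamma>))
        / (t n * l (x n) * exp (- (t n * \<psi> (x n))))) \<longlonglongrightarrow> - ln c"
proof -
  interpret prob_space \<gamma> by fact
  note [measurable_cong] = \<gamma>(2)
  define Q where "Q n k = (exp (- (t n * \<psi> (c * x n * k))) - exp (- (t n * \<psi> (x n * k))))
      / (t n * l (x n) * exp (- (t n * \<psi> (x n))))" for n k
  have m: "(\<lambda>g::'a. \<psi> (s * norm g)) \<in> borel_measurable \<gamma>" if "s \<ge> 0" for s
  proof -
    have "(\<lambda>g::'a. s * norm g) \<in> borel_measurable \<gamma>" by simp
    from measurable_compose[OF this \<psi>_meas] show ?thesis using that by simp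
  qed
  have em: "(\<lambda>g::'a. exp (- (t n * \<psi> (s * norm g)))) \<in> borel_measurable \<gamma>" if "s \<ge> 0" for s n
    by (intro borel_measurable_exp[THEN measurable_compose[rotated]] borel_measurable_uminus
        borel_measurable_times borel_measurable_const m that)
  have int: "integrable \<gamma> (\<lambda>g::'a. exp (- (t n * \<psi> (s * norm g))))" if "s \<ge> 0" for s n
    using that t(1)[of n] \<psi>_nonneg
    by (intro integrable_const_bound[where B=1] em) (auto simp: mult_nonneg_nonneg less_imp_le)
  have eq: "(\<integral>g. Q n (norm g) \<partial>\<gamma>) = ((\<integral>g. exp (- (t n * \<psi> (c * x n * norm g))) \<partial>\<gamma>) -
      (\<integral>g. exp (- (t n * \<psi> (x n * norm g))) \<partial>\<gamma>)) / (t n * l (x n) * exp (- (t n * \<psi> (x n))))" for n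
    unfolding Q_def using x(1)[of n] c
    by (subst integral_divide_zero, subst Bochner_Integration.integral_diff) (auto intro!: int)
  have Qm: "(\<lambda>g. Q n (norm g)) \<in> borel_measurable \<gamma>" for n
    unfolding Q_def using x(1)[of n] c
    by (intro borel_measurable_divide borel_measurable_diff em borel_measurable_const) auto
  \<comment> \<open>Both terms are compared with the argument \<open>x n\<close>, with factors
    \<open>c * k\<close> and \<open>k\<close>; the contributions \<open>ln k\<close> cancel.\<close>
  have lim: "(\<lambda>n. Q n k) \<longlonglongrightarrow> - ln c" if k: "k > 0" for k
  proof -
    have "(\<lambda>n. (exp (- (t n * (\<psi> (c * k * x n) - \<psi> (x n)))) - 1) / (t n * l (x n)) -
       (exp (- (t n * (\<psi> (k * x n) - \<psi> (x n)))) - 1) / (t n * l (x n))) \<longlonglongrightarrow> - ln (c * k) - (- ln k)"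
      using c k by (intro tendsto_diff exponent_increment_tendsto[OF sv lbd Pi t x(2)]) auto
    moreover have "(exp (- (t n * (\<psi> (c * k * x n) - \<psi> (x n)))) - 1) / (t n * l (x n)) -
       (exp (- (t n * (\<psi> (k * x n) - \<psi> (x n)))) - 1) / (t n * l (x n)) = Q n k" for n
    proof -
      have "exp (- (t n * (\<psi> y - \<psi> (x n)))) = exp (- (t n * \<psi> y)) / exp (- (t n * \<psi> (x n)))" for y
        by (simp add: exp_diff[symmetric] algebra_simps)
      then show ?thesis unfolding Q_def
        by (simp add: diff_divide_distrib[symmetric] mult_ac)
    qed
    ultimately show ?thesis using c k by (simp add: ln_mult)
  qed
  obtain C where "eventually (\<lambda>n. \<forall>k>0. \<bar>exp (- (t n * \<psi> (c * x n * k))) - exp (- (t n * \<psi> (x n * k)))\<bar>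
        / (t n * l (x n) * exp (- (t n * \<psi> (x n)))) \<le> C * (k powr (1/2) + k powr (-1/2))) sequentially"
    by (rule exponent_increment_bound[OF \<psi>_nonneg \<psi>_meas l_meas sv lbd Pi t x(2) t\<psi> c])
  moreover have "eventually (\<lambda>n. l (x n) > 0) sequentially"
  proof -
    obtain a where "\<And>y. y \<ge> a \<Longrightarrow> 0 < l y" using sv by (auto simp: slowly_varying_infty_def)
    moreover have "eventually (\<lambda>n. x n \<ge> a) sequentially" using x(2) unfolding filterlim_at_top by blast
    ultimately show ?thesis by (auto elim: eventually_mono)
  qed
  ultimately have "eventually (\<lambda>n. \<forall>k>0. \<bar>Q n k\<bar> \<le> C * (k powr (1/2) + k powr (-1/2))) sequentially"
  proof eventually_elim
    case (elim n)
    then have "\<bar>t n * l (x n) * exp (- (t n * \<psi> (x n)))\<bar> = t n * l (x n) * exp (- (t n * \<psi> (x n)))"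
      using t(1)[of n] by simp
    then show ?case using elim(1) by (simp only: Q_def abs_divide)
  qed
  \<comment> \<open>The majorant is valid only from some index on, so dominated convergence is
    applied to the sequence shifted by \<open>N\<close>.\<close>
  then obtain N where N: "\<And>n k. n \<ge> N \<Longrightarrow> k > 0 \<Longrightarrow> \<bar>Q n k\<bar> \<le> C * (k powr (1/2) + k powr (-1/2))"
    by (auto simp: eventually_sequentially)
  have "(\<lambda>n. \<integral>g. Q (n + N) (norm g) \<partial>\<gamma>) \<longlonglongrightarrow> (\<integral>g. - ln c \<partial>\<gamma>)"
  proof (rule integral_dominated_convergence)
    show "integrable \<gamma> (\<lambda>g. C * (norm g powr (1/2) + norm g powr (-1/2)))"
      using \<gamma>(3) by (rule integrable_mult_right)
    show "AE g in \<gamma>. (\<lambda>n. Q (n + N) (norm g)) \<longlonglongrightarrow> - ln c"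
      using \<gamma>(4) by eventually_elim (auto intro!: LIMSEQ_ignore_initial_segment lim)
    show "AE g in \<gamma>. norm (Q (n + N) (norm g)) \<le> C * (norm g powr (1/2) + norm g powr (-1/2))" for n
      using \<gamma>(4)
    proof eventually_elim
      case (elim g) then show ?case using N[of "n + N" "norm g"] by simp
    qed
  qed (auto intro: Qm)
  then have "(\<lambda>n. \<integral>g. Q n (norm g) \<partial>\<gamma>) \<longlonglongrightarrow> - ln c"
    using LIMSEQ_offset[of "\<lambda>n. \<integral>g. Q n (norm g) \<partial>\<gamma>" N] by (simp add: prob_space)
  then show ?thesis by (simp add: eq)
qed

section \<open>A Tauberian step by moments\<close>

text \<open>Up to the factor \<open>1/2\<close>, this is the density of the limit of \<open>y\<^sup>2 (1 - y)\<close> times the law of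
  \<open>y = exp (- s\<^sup>2 / 2)\<close>, where \<open>s\<close> has the infinite measure \<open>ds / s\<close>. The integral form makes it
  continuous at both end points and gives its moments by exchanging integrals.\<close>

definition moment_weight :: "real \<Rightarrow> real" where
  "moment_weight y = integral {0..1} (\<lambda>s. y powr (1 + s))"

lemma moment_weight_eq:
  assumes "0 < y" "y < 1"
  shows "moment_weight y = y * (1 - y) / (- ln y)"
proof -
  have ln: "ln y < 0" using assms by simp
  have "((\<lambda>s. exp ((1 + s) * ln y)) has_integral (exp ((1 + 1) * ln y) / ln y - exp ((1 + 0) * ln y) / ln y)) {0..1}"
    using ln assms by (intro fundamental_theorem_of_calculus)
      (auto intro!: derivative_eq_intros simp: has_real_derivative_iff_has_vector_derivative[symmetric] )
  then have "((\<lambda>s. y powr (1 + s)) has_integral (y powr (1 + 1) / ln y - y powr (1 + 0) / ln y)) {0..1}"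
    using assms by (simp add: powr_def)
  then have "moment_weight y = y powr (1 + 1) / ln y - y powr (1 + 0) / ln y"
    unfolding moment_weight_def by (rule integral_unique)
  also have "\<dots> = y * (1 - y) / (- ln y)"
    using assms ln by (simp add: field_simps power2_eq_square powr_add)
  finally show ?thesis .
qed

text \<open>The exponent is at least 1, which gives joint continuity also at \<open>y = 0\<close>.
  With the weight \<open>y (1 - y)\<close> the exponent could be 0, and continuity would fail at the
  corner (0, 0).\<close>

lemma continuous_on_powr_param:
  "continuous_on ({0..1} \<times> {0..1}) (\<lambda>(y::real, s::real). y powr (r + 1 + s))" if "r \<ge> 0"
  unfolding split_beta using that by (intro continuous_on_powr' continuous_intros) auto

lemma continuous_on_moment_weight: "continuous_on {0..1} moment_weight"
proof -
  have "continuous_on {0..1} (\<lambda>y::real. integral (cbox 0 1) (\<lambda>s. y powr (1 + s)))"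
    using continuous_on_powr_param[of 0]
    by (intro integral_continuous_on_param) (auto simp: split_beta cbox_interval)
  then show ?thesis by (simp add: moment_weight_def[abs_def])
qed

text \<open>No restriction on \<open>y\<close> is required: an integral that does not exist has the
  value 0.\<close>

lemma moment_weight_nonneg: "moment_weight y \<ge> 0"
  unfolding moment_weight_def by (cases "(\<lambda>s. y powr (1 + s)) integrable_on {0..1}")
    (auto intro: integral_nonneg simp: not_integrable_integral)

lemma integral_moment_weight_power:
  "integral {0..1} (\<lambda>y. moment_weight y * y ^ k) = ln ((real k + 3) / (real k + 2))"
proof -
  have "integral {0..1} (\<lambda>y. moment_weight y * y ^ k) =
    integral {0..1} (\<lambda>y. integral {0..1} (\<lambda>s. y powr (real k + 1 + s)))"
  proof (rule integral_cong)
    fix y :: real assume y: "y \<in> {0..1}"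
    have "moment_weight y * y ^ k = integral {0..1} (\<lambda>s. y powr (1 + s) * y ^ k)"
      unfolding moment_weight_def by simp
    also have "\<dots> = integral {0..1} (\<lambda>s. y powr (real k + 1 + s))"
    proof (rule integral_cong)
      fix s :: real assume "s \<in> {0..1}"
      \<comment> \<open>At \<open>y = 0\<close> both sides are 0, also for \<open>k = 0\<close>,
        since \<open>0 powr a = 0\<close>.\<close>
      then show "y powr (1 + s) * y ^ k = y powr (real k + 1 + s)"
        using y by (cases "y = 0") (auto simp: powr_add powr_realpow)
    qed
    finally show "moment_weight y * y ^ k = integral {0..1} (\<lambda>s. y powr (real k + 1 + s))" .
  qed
  also have "\<dots> = integral {0..1} (\<lambda>s. integral {0..1} (\<lambda>y. y powr (real k + 1 + s)))"
    using integral_swap_continuous[of 0 0 1 1 "\<lambda>y s. y powr (real k + 1 + s)"]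
      continuous_on_powr_param[of "real k"] by (simp add: cbox_Pair_eq)
  also have "\<dots> = integral {0..1} (\<lambda>s. 1 / (real k + 2 + s))"
  proof (rule integral_cong)
    fix s :: real assume s: "s \<in> {0..1}"
    have "((\<lambda>y. y powr (real k + 1 + s)) has_integral (1 powr (real k + 1 + s + 1) / (real k + 1 + s + 1))) {0..1}"
      using s by (intro has_integral_powr_from_0) auto
    then show "integral {0..1} (\<lambda>y. y powr (real k + 1 + s)) = 1 / (real k + 2 + s)"
      by (simp add: integral_unique add_ac)
  qed
  also have "\<dots> = ln (real k + 2 + 1) - ln (real k + 2 + 0)"
    by (intro integral_unique fundamental_theorem_of_calculus)
      (auto intro!: derivative_eq_intros simp: has_real_derivative_iff_has_vector_derivative[symmetric])
  also have "\<dots> = ln ((real k + 3) / (real k + 2))" by (simp add: ln_div add_ac)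
  finally show ?thesis .
qed

text \<open>The weighted laws divided by \<open>w\<close> live on the compact interval [0, 1], and
  the case \<open>k = 0\<close> of the hypothesis bounds their total masses. Hence convergence on
  polynomials passes to uniform limits.\<close>

lemma moment_convergence:
  fixes P :: "nat \<Rightarrow> 'a measure" and Y :: "nat \<Rightarrow> 'a \<Rightarrow> real"
  assumes P: "\<And>n. prob_space (P n)"
    and Ym[measurable]: "\<And>n. Y n \<in> borel_measurable (P n)" and Y: "\<And>n z. Y n z \<in> {0..1}"
    and w: "eventually (\<lambda>n. w n > 0) sequentially"
    and mom: "\<And>k. (\<lambda>n. (\<integral>z. (Y n z)\<^sup>2 * (1 - Y n z) * (Y n z) ^ k \<partial>P n) / w n)
      \<longlonglongrightarrow> ln ((real k + 3) / (real k + 2)) / 2"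
    and f: "continuous_on UNIV f"
  shows "(\<lambda>n. (\<integral>z. (Y n z)\<^sup>2 * (1 - Y n z) * f (Y n z) \<partial>P n) / w n)
    \<longlonglongrightarrow> integral {0..1} (\<lambda>y. moment_weight y * f y) / 2"
proof -
  define L where "L n g = (\<integral>z. (Y n z)\<^sup>2 * (1 - Y n z) * g (Y n z) \<partial>P n) / w n" for n and g :: "real \<Rightarrow> real"
  define J where "J g = integral {0..1} (\<lambda>y. moment_weight y * g y) / 2" for g
  have int: "integrable (P n) (\<lambda>z. (Y n z)\<^sup>2 * (1 - Y n z) * g (Y n z))" if g: "continuous_on UNIV g" for n g
  proof -
    interpret prob_space "P n" by fact
    have [measurable]: "g \<in> borel_measurable borel" using g by (rule borel_measurable_continuous_onI)
    have "compact ((\<lambda>y. y\<^sup>2 * (1 - y) * g y) ` {0..1})"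
      by (intro compact_continuous_image continuous_intros continuous_on_subset[OF g]) auto
    then obtain K where K: "\<And>y. y \<in> {0..1} \<Longrightarrow> norm (y\<^sup>2 * (1 - y) * g y) \<le> K"
      by (meson bounded_iff compact_imp_bounded imageI)
    show ?thesis by (rule integrable_const_bound[where B=K]) (use K[OF Y] in auto)
  qed
  have intJ: "(\<lambda>y. moment_weight y * g y) integrable_on {0..1}" if g: "continuous_on UNIV g" for g
    by (intro integrable_continuous_real continuous_intros continuous_on_moment_weight
        continuous_on_subset[OF g]) auto
  have Lp: "(\<lambda>n. L n (\<lambda>y. y ^ k)) \<longlonglongrightarrow> J (\<lambda>y. y ^ k)" for k
    using mom[of k] by (simp add: L_def J_def integral_moment_weight_power)
  have Lpoly: "(\<lambda>n. L n g) \<longlonglongrightarrow> J g" if g: "real_polynomial_function g" for g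
  proof -
    obtain a m where g: "g = (\<lambda>x. \<Sum>i\<le>m. a i * x ^ i)"
      using g by (auto simp: real_polynomial_function_iff_sum)
    have "L n g = (\<Sum>i\<le>m. a i * L n (\<lambda>y. y ^ i))" for n
    proof -
      have "(\<integral>z. (Y n z)\<^sup>2 * (1 - Y n z) * g (Y n z) \<partial>P n) =
        (\<integral>z. (\<Sum>i\<le>m. a i * ((Y n z)\<^sup>2 * (1 - Y n z) * (Y n z) ^ i)) \<partial>P n)"
        by (intro Bochner_Integration.integral_cong refl) (simp add: g sum_distrib_left mult_ac)
      also have "\<dots> = (\<Sum>i\<le>m. a i * (\<integral>z. (Y n z)\<^sup>2 * (1 - Y n z) * (Y n z) ^ i \<partial>P n))"
        by (subst Bochner_Integration.integral_sum) (auto intro!: int continuous_intros)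
      finally show ?thesis by (simp add: L_def sum_divide_distrib)
    qed
    moreover have "J g = (\<Sum>i\<le>m. a i * J (\<lambda>y. y ^ i))"
    proof -
      have "integral {0..1} (\<lambda>y. moment_weight y * g y) =
        integral {0..1} (\<lambda>y. \<Sum>i\<le>m. a i * (moment_weight y * y ^ i))"
        by (intro integral_cong) (simp add: g sum_distrib_left mult_ac)
      also have "\<dots> = (\<Sum>i\<le>m. a i * integral {0..1} (\<lambda>y. moment_weight y * y ^ i))"
        by (subst Henstock_Kurzweil_Integration.integral_sum)
           (auto intro!: integrable_on_mult_right intJ continuous_intros)
      finally show ?thesis by (simp add: J_def sum_divide_distrib)
    qed
    ultimately show ?thesis by (auto intro!: tendsto_sum tendsto_mult Lp)
  qed
  \<comment> \<open>\<open>K\<close> exceeds the limit of the total masses, so eventually it bounds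
    them as well. With \<open>d = e / (3 * K)\<close> the errors of replacing \<open>f\<close> by
    \<open>g\<close>, in \<open>L n\<close> and in \<open>J\<close>, each stay below
    \<open>e / 3\<close>.\<close>
  define K where "K = J (\<lambda>y. 1) + 1"
  have K: "K > 0"
  proof -
    have "J (\<lambda>y. 1) \<ge> 0" unfolding J_def using intJ[of "\<lambda>_. 1"]
      by (auto intro!: integral_nonneg moment_weight_nonneg)
    then show ?thesis by (simp add: K_def)
  qed
  have "(\<lambda>n. L n f) \<longlonglongrightarrow> J f"
  proof (rule LIMSEQ_I)
    fix e :: real assume e: "e > 0"
    define d where "d = e / (3 * K)"
    have d: "d > 0" using e K by (simp add: d_def)
    have "continuous_on {0..1} f" by (rule continuous_on_subset[OF f]) simp
    from Stone_Weierstrass_real_polynomial_function[OF compact_Icc this d]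
    obtain g where g: "real_polynomial_function g" "\<And>y. y \<in> {0..1} \<Longrightarrow> \<bar>f y - g y\<bar> < d" by blast
    have gc: "continuous_on UNIV g" using g(1) by (auto simp: real_polynomial_function_iff_sum intro!: continuous_intros)
    have Jfg: "\<bar>J f - J g\<bar> \<le> d * J (\<lambda>y. 1)"
    proof -
      have "\<bar>integral {0..1} (\<lambda>y. moment_weight y * f y) - integral {0..1} (\<lambda>y. moment_weight y * g y)\<bar>
        = norm (integral {0..1} (\<lambda>y. moment_weight y * f y - moment_weight y * g y))"
        using f gc by (subst Henstock_Kurzweil_Integration.integral_diff) (auto intro: intJ)
      also have "\<dots> \<le> integral {0..1} (\<lambda>y. d * (moment_weight y * 1))"
      proof (rule integral_norm_bound_integral)
        show "(\<lambda>y. moment_weight y * f y - moment_weight y * g y) integrable_on {0..1}"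
          by (intro integrable_diff intJ f gc)
        show "(\<lambda>y. d * (moment_weight y * 1)) integrable_on {0..1}"
          by (intro integrable_on_mult_right intJ continuous_intros)
        fix y :: real assume y: "y \<in> {0..1}"
        have "norm (moment_weight y * f y - moment_weight y * g y) = moment_weight y * \<bar>f y - g y\<bar>"
          using moment_weight_nonneg[of y] by (simp add: abs_mult flip: right_diff_distrib)
        also have "\<dots> \<le> moment_weight y * d" using g(2)[OF y] moment_weight_nonneg[of y] by (intro mult_left_mono) auto
        finally show "norm (moment_weight y * f y - moment_weight y * g y) \<le> d * (moment_weight y * 1)" by (simp add: mult.commute)
      qed
      finally show ?thesis by (simp add: J_def flip: diff_divide_distrib)
    qed
    have Lfg: "\<bar>L n f - L n g\<bar> \<le> d * L n (\<lambda>y. 1)" if wn: "w n > 0" for n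
    proof -
      have "\<bar>(\<integral>z. (Y n z)\<^sup>2 * (1 - Y n z) * f (Y n z) \<partial>P n) - (\<integral>z. (Y n z)\<^sup>2 * (1 - Y n z) * g (Y n z) \<partial>P n)\<bar>
        = norm (\<integral>z. (Y n z)\<^sup>2 * (1 - Y n z) * f (Y n z) - (Y n z)\<^sup>2 * (1 - Y n z) * g (Y n z) \<partial>P n)"
        by (subst Bochner_Integration.integral_diff) (auto intro: int f gc)
      also have "\<dots> \<le> (\<integral>z. d * ((Y n z)\<^sup>2 * (1 - Y n z) * 1) \<partial>P n)"
      unfolding real_norm_def
      proof (rule order_trans[OF integral_abs_bound integral_mono])
        show "integrable (P n) (\<lambda>z. \<bar>(Y n z)\<^sup>2 * (1 - Y n z) * f (Y n z) - (Y n z)\<^sup>2 * (1 - Y n z) * g (Y n z)\<bar>)"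
          by (intro integrable_abs Bochner_Integration.integrable_diff int f gc)
        show "integrable (P n) (\<lambda>z. d * ((Y n z)\<^sup>2 * (1 - Y n z) * 1))"
          by (intro integrable_mult_right int continuous_intros)
        fix z
        have nn: "0 \<le> (Y n z)\<^sup>2 * (1 - Y n z)" using Y[of n z] by simp
        have "norm ((Y n z)\<^sup>2 * (1 - Y n z) * f (Y n z) - (Y n z)\<^sup>2 * (1 - Y n z) * g (Y n z))
          = ((Y n z)\<^sup>2 * (1 - Y n z)) * \<bar>f (Y n z) - g (Y n z)\<bar>"
          using nn unfolding right_diff_distrib[symmetric] real_norm_def abs_mult[of "(Y n z)\<^sup>2 * (1 - Y n z)"] by simp
        also have "\<dots> \<le> ((Y n z)\<^sup>2 * (1 - Y n z)) * d" using g(2)[OF Y] nn by (intro mult_left_mono) (auto simp: less_imp_le)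
        finally show "abs ((Y n z)\<^sup>2 * (1 - Y n z) * f (Y n z) - (Y n z)\<^sup>2 * (1 - Y n z) * g (Y n z))
          \<le> d * ((Y n z)\<^sup>2 * (1 - Y n z) * 1)" by (simp only: real_norm_def mult_ac mult_1)
      qed
      also have "\<dots> = d * (\<integral>z. (Y n z)\<^sup>2 * (1 - Y n z) * 1 \<partial>P n)" by (rule integral_mult_right_zero)
      finally show ?thesis unfolding L_def using wn
        by (simp add: divide_right_mono flip: diff_divide_distrib)
    qed
    have "(\<lambda>n. L n (\<lambda>y. 1)) \<longlonglongrightarrow> J (\<lambda>y. 1)" using Lp[of 0] by simp
    then have e1: "eventually (\<lambda>n. L n (\<lambda>y. 1) < K) sequentially"
      by (rule order_tendstoD) (simp add: K_def)
    have e2: "eventually (\<lambda>n. norm (L n g - J g) < e / 3) sequentially"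
      using tendstoD[OF Lpoly[OF g(1)], of "e / 3"] e unfolding dist_norm by linarith
    have "eventually (\<lambda>n. norm (L n f - J f) < e) sequentially"
      using e1 e2 w
    proof eventually_elim
      case (elim n)
      have "d * L n (\<lambda>y. 1) < d * K" using elim d by simp
      moreover have "d * J (\<lambda>y. 1) < d * K" using d by (simp add: K_def)
      moreover have "d * K = e / 3" using K by (simp add: d_def)
      ultimately show ?case using Lfg[OF elim(3)] Jfg elim(2) unfolding real_norm_def by linarith
    qed
    then show "\<exists>N. \<forall>n\<ge>N. norm (L n f - J f) < e" by (simp add: eventually_sequentially)
  qed
  then show ?thesis by (simp add: L_def J_def)
qed

text \<open>For \<open>y = exp (- s\<^sup>2 / 2)\<close> this is \<open>ln s\<close> minus the
  constant \<open>ln 2 / 2\<close>, so differences of \<open>log_log\<close> are logarithms of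
  ratios of radii. Its negative is an antiderivative of the density
  \<open>1 / (2 y (- ln y))\<close> of the limit measure in the variable \<open>y\<close>.\<close>

definition log_log :: "real \<Rightarrow> real" where
  "log_log y = ln (- ln y) / 2"

lemma isCont_log_log: "0 < y \<Longrightarrow> y < 1 \<Longrightarrow> isCont log_log y"
  unfolding log_log_def[abs_def] by (intro continuous_intros) auto

lemma has_integral_log_log:
  assumes "0 < A" "A \<le> B" "B < 1"
  shows "((\<lambda>y. 1 / (y * (- ln y))) has_integral (2 * (log_log A - log_log B))) {A..B}"
proof -
  have "((\<lambda>y. 1 / (y * (- ln y))) has_integral (- ln (- ln B) - (- ln (- ln A)))) {A..B}"
  proof (rule fundamental_theorem_of_calculus)
    fix y assume y: "y \<in> {A..B}"
    then have "ln y < 0" "0 < y" using assms by auto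
    then show "((\<lambda>y. - ln (- ln y)) has_vector_derivative 1 / (y * - ln y)) (at y within {A..B})"
      by (auto intro!: derivative_eq_intros simp: has_real_derivative_iff_has_vector_derivative[symmetric] field_simps)
  qed (use assms in auto)
  then show ?thesis by (simp add: log_log_def algebra_simps)
qed

text \<open>A trapezoid divided by the weight: \<open>y\<^sup>2 * (1 - y) * f y\<close> lies between
  the indicators of [A, B] and (A', B'). In \<open>moment_weight y * f y\<close> the same weight
  cancels, leaving the trapezoid times \<open>1 / (y * (- ln y))\<close>, whose integral lies
  between explicit differences of \<open>log_log\<close>.\<close>

lemma bump_function:
  fixes A' A B B' :: real
  assumes "0 < A'" "A' < A" "A \<le> B" "B < B'" "B' < 1"
  obtains f :: "real \<Rightarrow> real" where "continuous_on UNIV f"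
    "\<And>y. y\<^sup>2 * (1 - y) * f y \<in> {0..1}"
    "\<And>y. A \<le> y \<Longrightarrow> y \<le> B \<Longrightarrow> y\<^sup>2 * (1 - y) * f y = 1"
    "\<And>y. y \<notin> {A'<..<B'} \<Longrightarrow> f y = 0"
    "log_log A - log_log B \<le> integral {0..1} (\<lambda>y. moment_weight y * f y) / 2"
    "integral {0..1} (\<lambda>y. moment_weight y * f y) / 2 \<le> log_log A' - log_log B'"
proof -
  define \<tau> where "\<tau> y = max 0 (min 1 (min ((y - A') / (A - A')) ((B' - y) / (B' - B))))" for y
  \<comment> \<open>Clamping the argument keeps the denominator away from its zeros 0 and 1, so that
    \<open>f\<close> is continuous on the whole line; where the clamp acts, \<open>\<tau>\<close>
    vanishes.\<close>
  define c where "c y = max A' (min B' y)" for y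
  define f where "f y = \<tau> y / ((c y)\<^sup>2 * (1 - c y))" for y
  have c: "0 < c y" "c y < 1" for y using assms by (auto simp: c_def max_def min_def)
  have f_cont: "continuous_on UNIV f"
  proof -
    have "continuous_on UNIV \<tau>" unfolding \<tau>_def using assms by (intro continuous_intros) auto
    moreover have "continuous_on UNIV c" unfolding c_def by (intro continuous_intros)
    moreover have "(c y)\<^sup>2 * (1 - c y) \<noteq> 0" for y using c[of y] by simp
    ultimately show ?thesis unfolding f_def by (intro continuous_intros) auto
  qed
  have \<tau>01: "\<tau> y \<in> {0..1}" for y by (auto simp: \<tau>_def)
  have \<tau>0: "\<tau> y = 0" if "y \<notin> {A'<..<B'}" for y
  proof -
    have "y \<le> A' \<or> y \<ge> B'" using that by auto
    then have "(y - A') / (A - A') \<le> 0 \<or> (B' - y) / (B' - B) \<le> 0"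
      using assms by (auto simp: divide_le_0_iff)
    then show ?thesis by (auto simp: \<tau>_def)
  qed
  have \<tau>1: "\<tau> y = 1" if "A \<le> y" "y \<le> B" for y
  proof -
    have "(y - A') / (A - A') \<ge> 1" "(B' - y) / (B' - B) \<ge> 1"
      using that assms by (auto simp: le_divide_eq)
    then show ?thesis by (auto simp: \<tau>_def)
  qed
  have f\<tau>: "y\<^sup>2 * (1 - y) * f y = \<tau> y" for y
  proof (cases "y \<in> {A'<..<B'}")
    case True
    then have "c y = y" by (auto simp: c_def)
    then show ?thesis using c[of y] by (simp add: f_def)
  next
    case False then show ?thesis by (simp add: f_def \<tau>0)
  qed
  have f0: "f y = 0" if "y \<notin> {A'<..<B'}" for y using \<tau>0[OF that] by (simp add: f_def)
  have fnn: "f y \<ge> 0" for y using \<tau>01[of y] c[of y] by (auto simp: f_def)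
  have wf: "moment_weight y * f y = \<tau> y * (1 / (y * (- ln y)))" if "0 < y" "y < 1" for y
  proof -
    have "moment_weight y * f y = (y\<^sup>2 * (1 - y) * f y) * (1 / (y * (- ln y)))"
      using that by (simp add: moment_weight_eq power2_eq_square)
    then show ?thesis by (simp only: f\<tau>)
  qed
  have int: "(\<lambda>y. moment_weight y * f y) integrable_on {a..b}" if "{a..b} \<subseteq> {0..1}" for a b
    by (intro integrable_continuous_real continuous_intros continuous_on_subset[OF f_cont]
        continuous_on_subset[OF continuous_on_moment_weight that]) auto
  have pos: "1 / (y * (- ln y)) \<ge> 0" if "0 < y" "y < 1" for y :: real
  proof -
    have "0 \<le> y * (- ln y)" using that by (intro mult_nonneg_nonneg) auto
    then show ?thesis by (simp only: zero_le_divide_1_iff)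
  qed
  have "2 * (log_log A - log_log B) \<le> integral {A..B} (\<lambda>y. moment_weight y * f y)"
  proof (rule has_integral_le[OF has_integral_log_log integrable_integral])
    show "(\<lambda>y. moment_weight y * f y) integrable_on {A..B}" using assms by (intro int) auto
    show "1 / (y * (- ln y)) \<le> moment_weight y * f y" if "y \<in> {A..B}" for y
      using that assms by (subst wf) (auto simp: \<tau>1)
  qed (use assms in auto)
  also have "\<dots> \<le> integral {0..1} (\<lambda>y. moment_weight y * f y)"
    using assms by (intro integral_subset_le int) (auto intro!: mult_nonneg_nonneg moment_weight_nonneg fnn)
  finally have lower: "log_log A - log_log B \<le> integral {0..1} (\<lambda>y. moment_weight y * f y) / 2" by simp
  have "integral {0..1} (\<lambda>y. moment_weight y * f y) =
    integral {0..1} (\<lambda>y. if y \<in> {A'..B'} then moment_weight y * f y else 0)"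
    by (intro integral_cong) (auto simp: f0)
  also have "\<dots> = integral {A'..B'} (\<lambda>y. moment_weight y * f y)"

    using assms by (intro integral_unique has_integral_restrict[THEN iffD2] integrable_integral int) auto
  also have "\<dots> \<le> 2 * (log_log A' - log_log B')"
  proof (rule has_integral_le[OF integrable_integral has_integral_log_log])
    show "(\<lambda>y. moment_weight y * f y) integrable_on {A'..B'}" using assms by (intro int) auto
    show "moment_weight y * f y \<le> 1 / (y * (- ln y))" if "y \<in> {A'..B'}" for y
    proof -
      have y: "0 < y" "y < 1" using that assms by auto
      have "\<tau> y * (1 / (y * (- ln y))) \<le> 1 * (1 / (y * (- ln y)))"
        using \<tau>01[of y] pos[OF y] by (intro mult_right_mono) auto
      then show ?thesis using wf[OF y] by simp
    qed
  qed (use assms in auto)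
  finally have upper: "integral {0..1} (\<lambda>y. moment_weight y * f y) / 2 \<le> log_log A' - log_log B'" by simp
  show thesis
    by (rule that[of f]) (use f_cont \<tau>01 \<tau>1 f\<tau> f0 lower upper in auto)
qed

text \<open>The indicator is squeezed between two bump functions, and continuity of
  \<open>log_log\<close> closes the gap. The interval is closed on the left and open on the right
  because \<open>y\<close> decreases with the radius and annuli are open at the inner
  radius.\<close>

lemma interval_mass_tendsto:
  fixes P :: "nat \<Rightarrow> 'a measure" and Y :: "nat \<Rightarrow> 'a \<Rightarrow> real"
  assumes P: "\<And>n. prob_space (P n)"
    and Ym[measurable]: "\<And>n. Y n \<in> borel_measurable (P n)" and Y: "\<And>n z. Y n z \<in> {0..1}"
    and w: "eventually (\<lambda>n. w n > 0) sequentially"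
    and mom: "\<And>k. (\<lambda>n. (\<integral>z. (Y n z)\<^sup>2 * (1 - Y n z) * (Y n z) ^ k \<partial>P n) / w n)
      \<longlonglongrightarrow> ln ((real k + 3) / (real k + 2)) / 2"
    and AB: "0 < A" "A < B" "B < 1"
  shows "(\<lambda>n. measure (P n) {z \<in> space (P n). A \<le> Y n z \<and> Y n z < B} / w n) \<longlonglongrightarrow> log_log A - log_log B"
proof (rule order_tendstoI)
  let ?S = "\<lambda>n. {z \<in> space (P n). A \<le> Y n z \<and> Y n z < B}"
  define L where "L n f = (\<integral>z. (Y n z)\<^sup>2 * (1 - Y n z) * f (Y n z) \<partial>P n) / w n" for n and f :: "real \<Rightarrow> real"
  have lim: "(\<lambda>n. L n f) \<longlonglongrightarrow> integral {0..1} (\<lambda>y. moment_weight y * f y) / 2" if "continuous_on UNIV f" for f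
    unfolding L_def by (rule moment_convergence[OF P Ym Y w mom that])
  have int: "integrable (P n) (\<lambda>z. (Y n z)\<^sup>2 * (1 - Y n z) * f (Y n z))"
    if f: "continuous_on UNIV f" "\<And>y. y\<^sup>2 * (1 - y) * f y \<in> {0..1}" for f n
  proof -
    interpret prob_space "P n" by fact
    have [measurable]: "f \<in> borel_measurable borel" using f(1) by (rule borel_measurable_continuous_onI)
    show ?thesis by (rule integrable_const_bound[where B=1]) (use f(2) in auto)
  qed
  have intS: "integrable (P n) (indicator (?S n) :: 'a \<Rightarrow> real)"
      and meas: "measure (P n) (?S n) = (\<integral>z. indicator (?S n) z \<partial>P n)" for n
  proof -
    interpret prob_space "P n" by fact
    show "integrable (P n) (indicator (?S n) :: 'a \<Rightarrow> real)"
      by (rule integrable_real_indicator) (auto simp: emeasure_eq_measure)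
    show "measure (P n) (?S n) = (\<integral>z. indicator (?S n) z \<partial>P n)" by simp
  qed
  have cA: "isCont log_log A" and cB: "isCont log_log B" using AB by (auto intro: isCont_log_log)
  {
    fix a assume a: "a < log_log A - log_log B"
    \<comment> \<open>Each end point is moved inwards at a cost below \<open>e\<close>, hence the
      factor 1/2; the midpoint of \<open>A\<close> and \<open>B\<close> keeps the moved points
      apart. The upper estimate moves them outwards instead.\<close>
    define e where "e = (log_log A - log_log B - a) / 2"
    have e: "e > 0" using a by (simp add: e_def)
    have "eventually (\<lambda>y. log_log y > log_log A - e) (at_right A)"
      using cA e by (intro order_tendstoD(1)[of log_log "log_log A"]) (auto simp: isCont_def intro: tendsto_within_subset)
    moreover have "eventually (\<lambda>y. y \<in> {A<..<(A+B)/2}) (at_right A)"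
      using AB by (intro eventually_at_right_real) auto
    ultimately have "\<exists>y. log_log y > log_log A - e \<and> y \<in> {A<..<(A+B)/2}"
      by (intro eventually_happens'[of "at_right A"] eventually_conj) auto
    then obtain A1 where A1: "log_log A1 > log_log A - e" "A < A1" "A1 < (A + B) / 2" by auto
    have "eventually (\<lambda>y. log_log y < log_log B + e) (at_left B)"
      using cB e by (intro order_tendstoD(2)[of log_log "log_log B"]) (auto simp: isCont_def intro: tendsto_within_subset)
    moreover have "eventually (\<lambda>y. y \<in> {(A+B)/2<..<B}) (at_left B)"
      using AB by (intro eventually_at_left_real) auto
    ultimately have "\<exists>y. log_log y < log_log B + e \<and> y \<in> {(A+B)/2<..<B}"
      by (intro eventually_happens'[of "at_left B"] eventually_conj) auto
    then obtain B1 where B1: "log_log B1 < log_log B + e" "(A + B) / 2 < B1" "B1 < B" by auto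
    obtain f where f: "continuous_on UNIV f" "\<And>y. y\<^sup>2 * (1 - y) * f y \<in> {0..1}"
      "\<And>y. y \<notin> {A<..<B} \<Longrightarrow> f y = 0"
      "log_log A1 - log_log B1 \<le> integral {0..1} (\<lambda>y. moment_weight y * f y) / 2"
      by (rule bump_function[of A A1 B1 B]) (use AB A1 B1 in auto)
    have "a = log_log A - log_log B - 2 * e" by (simp add: e_def field_simps)
    then have "a < integral {0..1} (\<lambda>y. moment_weight y * f y) / 2"
      using f(4) A1(1) B1(1) by linarith
    from order_tendstoD(1)[OF lim[OF f(1)] this]
    show "eventually (\<lambda>n. a < measure (P n) (?S n) / w n) sequentially"
      using w
    proof eventually_elim
      case (elim n)
      have "(\<integral>z. (Y n z)\<^sup>2 * (1 - Y n z) * f (Y n z) \<partial>P n) \<le> (\<integral>z. indicator (?S n) z \<partial>P n)"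
      proof (rule integral_mono[OF int[OF f(1,2)] intS])
        fix z assume z: "z \<in> space (P n)"
        show "(Y n z)\<^sup>2 * (1 - Y n z) * f (Y n z) \<le> indicator (?S n) z"
          using f(2)[of "Y n z"] f(3)[of "Y n z"] z by (cases "Y n z \<in> {A<..<B}") (auto simp: indicator_def)
      qed
      then have "L n f \<le> measure (P n) (?S n) / w n"
        unfolding L_def meas using elim by (intro divide_right_mono) auto
      then show ?case using elim by linarith
    qed
  next
    fix a assume a: "log_log A - log_log B < a"
    define e where "e = (a - (log_log A - log_log B)) / 2"
    have e: "e > 0" using a by (simp add: e_def)
    have "eventually (\<lambda>y. log_log y < log_log A + e) (at_left A)"
      using cA e by (intro order_tendstoD(2)[of log_log "log_log A"]) (auto simp: isCont_def intro: tendsto_within_subset)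
    moreover have "eventually (\<lambda>y. y \<in> {0<..<A}) (at_left A)"
      using AB by (intro eventually_at_left_real) auto
    ultimately have "\<exists>y. log_log y < log_log A + e \<and> y \<in> {0<..<A}"
      by (intro eventually_happens'[of "at_left A"] eventually_conj) auto
    then obtain A1 where A1: "log_log A1 < log_log A + e" "0 < A1" "A1 < A" by auto
    have "eventually (\<lambda>y. log_log y > log_log B - e) (at_right B)"
      using cB e by (intro order_tendstoD(1)[of log_log "log_log B"]) (auto simp: isCont_def intro: tendsto_within_subset)
    moreover have "eventually (\<lambda>y. y \<in> {B<..<1}) (at_right B)"
      using AB by (intro eventually_at_right_real) auto
    ultimately have "\<exists>y. log_log y > log_log B - e \<and> y \<in> {B<..<1}"
      by (intro eventually_happens'[of "at_right B"] eventually_conj) auto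
    then obtain B1 where B1: "log_log B1 > log_log B - e" "B < B1" "B1 < 1" by auto
    obtain f where f: "continuous_on UNIV f" "\<And>y. y\<^sup>2 * (1 - y) * f y \<in> {0..1}"
      "\<And>y. A \<le> y \<Longrightarrow> y \<le> B \<Longrightarrow> y\<^sup>2 * (1 - y) * f y = 1"
      "integral {0..1} (\<lambda>y. moment_weight y * f y) / 2 \<le> log_log A1 - log_log B1"
      by (rule bump_function[of A1 A B B1]) (use AB A1 B1 in auto)
    have "a = log_log A - log_log B + 2 * e" by (simp add: e_def field_simps)
    then have "integral {0..1} (\<lambda>y. moment_weight y * f y) / 2 < a"
      using f(4) A1(1) B1(1) by linarith
    from order_tendstoD(2)[OF lim[OF f(1)] this]
    show "eventually (\<lambda>n. measure (P n) (?S n) / w n < a) sequentially"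
      using w
    proof eventually_elim
      case (elim n)
      have "(\<integral>z. indicator (?S n) z \<partial>P n) \<le> (\<integral>z. (Y n z)\<^sup>2 * (1 - Y n z) * f (Y n z) \<partial>P n)"
      proof (rule integral_mono[OF intS int[OF f(1,2)]])
        fix z assume z: "z \<in> space (P n)"
        show "indicator (?S n) z \<le> (Y n z)\<^sup>2 * (1 - Y n z) * f (Y n z)"
          using f(2)[of "Y n z"] f(3)[of "Y n z"] z by (auto simp: indicator_def)
      qed
      then have "measure (P n) (?S n) / w n \<le> L n f"
        unfolding L_def meas using elim by (intro divide_right_mono) auto
      then show ?case using elim by linarith
    qed
  }
qed

section \<open>Mass of annuli and the transition density\<close>

text \<open>As long as \<open>u n\<close> stays below a level \<open>Z\<close>, \<psi>(u n) is
  bounded and \<open>t n \<psi>(u n)\<close> is small. So the joint limit regime alone forces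
  \<open>x n \<longrightarrow> 0\<close>.\<close>

lemma filterlim_at_top_if_exponent:
  fixes \<psi> :: "real \<Rightarrow> real" and t u :: "nat \<Rightarrow> real"
  assumes bd: "\<And>s. s \<ge> 0 \<Longrightarrow> \<psi> s \<le> C * (1 + s\<^sup>2)"
    and t: "\<And>n. t n > 0" "t \<longlonglongrightarrow> 0" and u: "\<And>n. u n > 0"
    and t\<psi>: "filterlim (\<lambda>n. t n * \<psi> (u n)) at_top sequentially"
  shows "filterlim u at_top sequentially"
proof -
  have "eventually (\<lambda>n. Z \<le> u n) sequentially" for Z
  proof -
    have "(\<lambda>n. t n * (\<bar>C\<bar> * (1 + Z\<^sup>2))) \<longlonglongrightarrow> 0" using tendsto_mult_right[OF t(2)] by simp
    then have "eventually (\<lambda>n. t n * (\<bar>C\<bar> * (1 + Z\<^sup>2)) < 1) sequentially"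
      by (rule order_tendstoD) simp
    moreover have "eventually (\<lambda>n. 1 \<le> t n * \<psi> (u n)) sequentially"
      using t\<psi> unfolding filterlim_at_top by blast
    ultimately show ?thesis
    proof eventually_elim
      case (elim n)
      show ?case
      proof (rule ccontr)
        assume "\<not> Z \<le> u n"
        then have "(u n)\<^sup>2 \<le> Z\<^sup>2" using u[of n] by (intro power_mono) auto
        then have "C * (1 + (u n)\<^sup>2) \<le> \<bar>C\<bar> * (1 + Z\<^sup>2)" by (intro mult_mono) auto
        then have "\<psi> (u n) \<le> \<bar>C\<bar> * (1 + Z\<^sup>2)" using bd[of "u n"] u[of n] by linarith
        then have "t n * \<psi> (u n) \<le> t n * (\<bar>C\<bar> * (1 + Z\<^sup>2))" using t(1)[of n] by (intro mult_left_mono) auto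
        then show False using elim by linarith
      qed
    qed
  qed
  then show ?thesis by (simp add: filterlim_at_top)
qed

lemma radial_mass_tendsto:
  fixes \<psi> l :: "real \<Rightarrow> real" and t u :: "nat \<Rightarrow> real" and P :: "nat \<Rightarrow> 'a::euclidean_space measure"
  assumes \<psi>_nonneg: "\<And>s. s \<ge> 0 \<Longrightarrow> 0 \<le> \<psi> s"
    and \<psi>_meas: "(\<lambda>s. \<psi> \<bar>s\<bar>) \<in> borel_measurable borel"
    and l_meas: "(\<lambda>s. l \<bar>s\<bar>) \<in> borel_measurable borel"
    and sv: "slowly_varying_infty l" and lbd: "\<exists>B a. \<forall>x\<ge>a. \<bar>l x\<bar> \<le> B"
    and Pi: "de_haan_class l \<psi>"
    and t: "\<And>n. t n > 0" "t \<longlonglongrightarrow> 0"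
    and u: "\<And>n. u n > 0" "filterlim u at_top sequentially"
    and t\<psi>: "filterlim (\<lambda>n. t n * \<psi> (u n)) at_top sequentially"
    and P: "\<And>n. prob_space (P n)" "\<And>n. sets (P n) = sets borel"
    and charf: "\<And>n \<xi>. (CLINT x | P n. cis (\<xi> \<bullet> x)) = complex_of_real (exp (- (t n * \<psi> (norm \<xi>))))"
    and ab: "0 < \<alpha>" "\<alpha> < \<beta>"
  shows "(\<lambda>n. measure (P n) {z. \<alpha> / u n < norm z \<and> norm z \<le> \<beta> / u n}
      / (t n * l (u n) * exp (- (t n * \<psi> (u n))))) \<longlonglongrightarrow> ln \<beta> - ln \<alpha>"
proof -
  obtain \<gamma> :: "'a measure" where \<gamma>: "prob_space \<gamma>" "sets \<gamma> = sets borel"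
    "\<And>z. (\<integral>g. cos (z \<bullet> g) \<partial>\<gamma>) = exp (- (norm z)\<^sup>2 / 2)"
    "integrable \<gamma> (\<lambda>g. norm g powr (1/2) + norm g powr (-1/2))"
    "AE g in \<gamma>. g \<noteq> 0" by (rule standard_gaussian_exists) blast
  define w where "w n = t n * l (u n) * exp (- (t n * \<psi> (u n)))" for n
  define Y where "Y n z = exp (- (u n * norm z)\<^sup>2 / 2)" for n and z :: 'a
  have wpos: "eventually (\<lambda>n. w n > 0) sequentially"
    using eventually_compose_filterlim[OF slowly_varying_eventually_pos[OF sv] u(2)]
    by eventually_elim (use t(1) in \<open>auto simp: w_def\<close>)
  have Ym: "Y n \<in> borel_measurable (P n)" for n
    unfolding Y_def measurable_cong_sets[OF P(2) refl] by simp
  have Y01: "Y n z \<in> {0..1}" for n z by (simp add: Y_def)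
  have Yint: "integrable (P n) (\<lambda>z. Y n z ^ j)" for n j
  proof -
    interpret prob_space "P n" by (rule P)
    show ?thesis using Y01[of n] Ym[of n]
      by (intro integrable_const_bound[where B=1] borel_measurable_power) (auto simp: power_le_one)
  qed
  define T where "T n c = (\<integral>g. exp (- (t n * \<psi> (c * u n * norm g))) \<partial>\<gamma>)" for n c
  \<comment> \<open>Powers of a Gaussian factor are Gaussian factors at another scale: the
    \<open>j\<close>-th power multiplies the scale by \<open>sqrt j\<close>. This is why polynomial
    moments are accessible.\<close>
  have YT: "(\<integral>z. Y n z ^ j \<partial>P n) = T n (sqrt (real j))" for n j
  proof -
    have "(\<integral>z. Y n z ^ j \<partial>P n) = (\<integral>z. exp (- ((sqrt (real j) * u n) * norm z)\<^sup>2 / 2) \<partial>P n)"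
      by (intro Bochner_Integration.integral_cong refl)
         (simp add: Y_def exp_of_nat_mult[symmetric] power_mult_distrib)
    also have "\<dots> = T n (sqrt (real j))"
      unfolding T_def using u(1)[of n]
      by (subst gaussian_transform[OF P \<gamma>(1-3) charf]) (simp add: abs_mult)
    finally show ?thesis .
  qed
  have Tlim: "(\<lambda>n. (T n c - T n 1) / w n) \<longlonglongrightarrow> - ln c" if "c > 0" for c
    using gaussian_mixture_increment_tendsto[OF \<psi>_nonneg \<psi>_meas l_meas sv lbd Pi t u t\<psi> that \<gamma>(1,2,4,5)]
    by (simp add: T_def w_def)
  have mom: "(\<lambda>n. (\<integral>z. (Y n z)\<^sup>2 * (1 - Y n z) * (Y n z) ^ k \<partial>P n) / w n)
      \<longlonglongrightarrow> ln ((real k + 3) / (real k + 2)) / 2" for k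
  proof -
    have eq: "(\<integral>z. (Y n z)\<^sup>2 * (1 - Y n z) * (Y n z) ^ k \<partial>P n) = T n (sqrt (real (k + 2))) - T n (sqrt (real (k + 3)))" for n
    proof -
      have "(\<integral>z. (Y n z)\<^sup>2 * (1 - Y n z) * (Y n z) ^ k \<partial>P n) = (\<integral>z. Y n z ^ (k + 2) - Y n z ^ (k + 3) \<partial>P n)"
        by (intro Bochner_Integration.integral_cong refl)
           (simp add: power_add algebra_simps power2_eq_square power3_eq_cube)
      then show ?thesis by (simp only: Bochner_Integration.integral_diff[OF Yint Yint] YT)
    qed
    \<comment> \<open>\<open>T n 1\<close> is a common reference value that cancels in the
      difference. The square roots of the scales produce the factor 1/2 in the limit.\<close>
    have lim: "(\<lambda>n. (T n (sqrt (real (k + 2))) - T n 1) / w n - (T n (sqrt (real (k + 3))) - T n 1) / w n)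
      \<longlonglongrightarrow> - ln (sqrt (real (k + 2))) - (- ln (sqrt (real (k + 3))))"
      by (intro tendsto_diff Tlim) auto
    have limit_eq: "- ln (sqrt (real (k + 2))) - (- ln (sqrt (real (k + 3)))) = ln ((real k + 3) / (real k + 2)) / 2"
      by (simp add: ln_sqrt ln_div field_simps)
    have "(a - c) / w n - (b - c) / w n = (a - b) / w n" for a b c n
      by (simp add: diff_divide_distrib)
    then show ?thesis using lim unfolding eq limit_eq by simp
  qed
  \<comment> \<open>The map from radius to \<open>Y\<close> is decreasing: the outer radius
    \<open>\<beta>\<close> gives the lower end \<open>A\<close>, the inner radius
    \<open>\<alpha>\<close> the upper end \<open>B\<close>.\<close>
  define A B where "A = exp (- \<beta>\<^sup>2 / 2)" and "B = exp (- \<alpha>\<^sup>2 / 2)"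
  have sq: "\<alpha>\<^sup>2 < \<beta>\<^sup>2" using ab by (intro power_strict_mono) auto
  have AB: "0 < A" "A < B" "B < 1" using ab sq by (auto simp: A_def B_def)
  have "(\<lambda>n. measure (P n) {z \<in> space (P n). A \<le> Y n z \<and> Y n z < B} / w n) \<longlonglongrightarrow> log_log A - log_log B"
    by (rule interval_mass_tendsto[OF P(1) Ym Y01 wpos mom AB])
  moreover have "{z \<in> space (P n). A \<le> Y n z \<and> Y n z < B} = {z. \<alpha> / u n < norm z \<and> norm z \<le> \<beta> / u n}" for n
  proof -
    have sp: "space (P n) = UNIV" using sets_eq_imp_space_eq[OF P(2)] by simp
    have "A \<le> Y n z \<longleftrightarrow> norm z \<le> \<beta> / u n" for z
    proof -
      have "A \<le> Y n z \<longleftrightarrow> (u n * norm z)\<^sup>2 \<le> \<beta>\<^sup>2" by (simp add: A_def Y_def)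
      also have "\<dots> \<longleftrightarrow> u n * norm z \<le> \<beta>" using ab u(1)[of n] by (subst power_mono_iff) auto
      finally show ?thesis using u(1)[of n] by (simp add: field_simps)
    qed
    moreover have "Y n z < B \<longleftrightarrow> \<alpha> / u n < norm z" for z
    proof -
      have "Y n z < B \<longleftrightarrow> \<alpha>\<^sup>2 < (u n * norm z)\<^sup>2" by (simp add: B_def Y_def)
      also have "\<dots> \<longleftrightarrow> \<alpha> < u n * norm z"
        using power_mono_iff[of "u n * norm z" \<alpha> 2] ab u(1)[of n]
        unfolding not_le[symmetric] by simp
      finally show ?thesis using u(1)[of n] by (simp add: field_simps)
    qed
    ultimately show ?thesis using sp by auto
  qed
  moreover have "log_log A - log_log B = ln \<beta> - ln \<alpha>"
    using ab by (simp add: log_log_def A_def B_def ln_div ln_realpow field_simps)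
  ultimately show ?thesis by (simp add: w_def)
qed

text \<open>The constant is the reciprocal of the surface area of the unit sphere, that is of
  \<open>d\<close> times the volume of the unit ball; the two forms agree by the functional equation
  of Gamma.\<close>

lemma unit_ball_vol_times_dim:
  assumes "d > 0"
  shows "1 / (unit_ball_vol (real d) * real d) = Gamma (real d / 2) / (2 * pi powr (real d / 2))"
proof -
  have "Gamma (real d / 2 + 1) = real d / 2 * Gamma (real d / 2)"
    using assms by (intro Gamma_plus1) (auto elim!: nonpos_Ints_cases)
  moreover have "Gamma (real d / 2) > 0" using assms by (intro Gamma_real_pos) auto
  ultimately show ?thesis using assms by (simp add: unit_ball_vol_def field_simps)
qed

lemma transition_density_tendsto:
  fixes M :: "'b measure" and X :: "real \<Rightarrow> 'b \<Rightarrow> 'a::euclidean_space"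
    and \<nu> :: "'a \<Rightarrow> real" and p :: "real \<Rightarrow> 'a \<Rightarrow> real"
    and \<psi> l :: "real \<Rightarrow> real" and t :: "nat \<Rightarrow> real" and x :: "nat \<Rightarrow> 'a"
  assumes levy: "isotropic_unimodal_levy M X \<nu>"
    and dens: "transition_density M X p"
    and p_dec: "\<And>t. t > 0 \<Longrightarrow> radially_nonincreasing (p t)"
    and psi_radial: "\<And>\<xi>. levy_exponent \<nu> \<xi> = \<psi> (norm \<xi>)"
    and \<psi>_nonneg: "\<And>s. s \<ge> 0 \<Longrightarrow> 0 \<le> \<psi> s"
    and \<psi>_meas: "(\<lambda>s. \<psi> \<bar>s\<bar>) \<in> borel_measurable borel"
    and l_meas: "(\<lambda>s. l \<bar>s\<bar>) \<in> borel_measurable borel"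
    and sv: "slowly_varying_infty l" and lbd: "\<exists>B a. \<forall>x\<ge>a. \<bar>l x\<bar> \<le> B"
    and Pi: "de_haan_class l \<psi>"
    and t: "\<And>n. t n > 0" "t \<longlonglongrightarrow> 0" and x: "\<And>n. x n \<noteq> 0"
    and ux: "filterlim (\<lambda>n. 1 / norm (x n)) at_top sequentially"
    and t\<psi>: "filterlim (\<lambda>n. t n * \<psi> (1 / norm (x n))) at_top sequentially"
  shows "(\<lambda>n. p (t n) (x n) /
        (t n * norm (x n) powr (- real DIM('a)) * l (1 / norm (x n))
          * exp (- (t n * \<psi> (1 / norm (x n))))))
     \<longlonglongrightarrow> Gamma (real DIM('a) / 2) / (2 * pi powr (real DIM('a) / 2))"
proof -
  define d where "d = DIM('a)"
  have d: "d > 0" by (simp add: d_def)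
  define v where "v = unit_ball_vol (real d)"
  have v: "v > 0" by (simp add: v_def)
  define r where "r n = norm (x n)" for n
  have r: "r n > 0" for n using x by (simp add: r_def)
  define P where "P n = distr M borel (X (t n))" for n
  define w where "w n = t n * l (1 / r n) * exp (- (t n * \<psi> (1 / r n)))" for n
  define q where "q n = p (t n) (x n) * r n ^ d / w n" for n
  have [measurable]: "X (t n) \<in> borel_measurable M" for n
    using levy t(1)[of n] by (auto simp: isotropic_unimodal_levy_def)
  have P: "prob_space (P n)" "sets (P n) = sets borel" for n
    using levy unfolding P_def
    by (auto simp: isotropic_unimodal_levy_def intro!: prob_space.prob_space_distr)
  have charf: "(CLINT x | P n. cis (\<xi> \<bullet> x)) = complex_of_real (exp (- (t n * \<psi> (norm \<xi>))))" for n \<xi>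
    using levy t(1)[of n] unfolding P_def psi_radial[symmetric] by (auto simp: isotropic_unimodal_levy_def)
  have wpos: "eventually (\<lambda>n. w n > 0) sequentially"
    using eventually_compose_filterlim[OF slowly_varying_eventually_pos[OF sv] ux]
    by eventually_elim (use t(1) in \<open>auto simp: w_def r_def\<close>)
  have mass: "(\<lambda>n. measure (P n) {z. \<alpha> * r n < norm z \<and> norm z \<le> \<beta> * r n} / w n) \<longlonglongrightarrow> ln \<beta> - ln \<alpha>"
    if "0 < \<alpha>" "\<alpha> < \<beta>" for \<alpha> \<beta>
    using radial_mass_tendsto[OF \<psi>_nonneg \<psi>_meas l_meas sv lbd Pi t _ ux t\<psi> P charf that] x
    by (simp add: w_def r_def)
  have emass: "emeasure (P n) {z. a < norm z \<and> norm z \<le> b}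
      = (\<integral>\<^sup>+ z\<in>{z. a < norm z \<and> norm z \<le> b}. ennreal (p (t n) z) \<partial>lborel)" if "0 \<le> a" for a b n
  proof -
    \<comment> \<open>The density describes the law only off the origin. Annuli with a strict inner
      inequality avoid this point.\<close>
    have eq: "{z::'a. a < norm z \<and> norm z \<le> b} - {0} = {z. a < norm z \<and> norm z \<le> b}" using that by auto
    have "\<forall>A\<in>sets borel. emeasure (P n) (A - {0}) = (\<integral>\<^sup>+ z\<in>A - {0}. ennreal (p (t n) z) \<partial>lborel)"
      using dens t(1)[of n] by (simp add: transition_density_def P_def)
    then have "emeasure (P n) ({z. a < norm z \<and> norm z \<le> b} - {0})
      = (\<integral>\<^sup>+ z\<in>{z. a < norm z \<and> norm z \<le> b} - {0}. ennreal (p (t n) z) \<partial>lborel)"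
      by (rule bspec) measurable
    then show ?thesis unfolding eq .
  qed
  have p_nonneg: "p (t n) z \<ge> 0" for n z using dens t(1)[of n] by (auto simp: transition_density_def)
  have dec: "p (t n) z' \<le> p (t n) z" if "0 < norm z" "norm z \<le> norm z'" for n z z'
    using p_dec[OF t(1)] that by (auto simp: radially_nonincreasing_def)
  \<comment> \<open>On the annulus inside the sphere through \<open>x n\<close> the density is at
    least \<open>p (t n) (x n)\<close>, on the one outside, used for \<open>lower\<close>, at most.
    The factor \<open>r n ^ d\<close> in \<open>q\<close> is the scaling of the volumes, so both
    bounds involve only the ratio of radii.\<close>
  have upper: "q n * (v * (1 - \<alpha> ^ d)) \<le> measure (P n) {z. \<alpha> * r n < norm z \<and> norm z \<le> 1 * r n} / w n"
    if "w n > 0" "0 < \<alpha>" "\<alpha> < 1" for n \<alpha>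
  proof -
    have "p (t n) (x n) * (unit_ball_vol (real DIM('a)) * ((1 * r n) ^ DIM('a) - (\<alpha> * r n) ^ DIM('a)))
      \<le> measure (P n) {z. \<alpha> * r n < norm z \<and> norm z \<le> 1 * r n}"
    proof (rule annulus_mass_bounds(1)[OF P(1) _ _ emass p_nonneg])
      fix z :: 'a assume z: "\<alpha> * r n < norm z" "norm z \<le> 1 * r n"
      have "0 < norm z" using z(1) mult_pos_pos[OF that(2) r[of n]] by linarith
      then show "p (t n) (x n) \<le> p (t n) z" using z by (intro dec) (auto simp: r_def)
    qed (use that r[of n] in auto)
    moreover have "q n * (v * (1 - \<alpha> ^ d)) =
      p (t n) (x n) * (unit_ball_vol (real DIM('a)) * ((1 * r n) ^ DIM('a) - (\<alpha> * r n) ^ DIM('a))) / w n"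
      by (simp add: q_def v_def d_def power_mult_distrib algebra_simps)
    ultimately show ?thesis using that by (simp only: divide_right_mono less_imp_le)
  qed
  have lower: "measure (P n) {z. 1 * r n < norm z \<and> norm z \<le> \<beta> * r n} / w n \<le> q n * (v * (\<beta> ^ d - 1))"
    if "w n > 0" "1 < \<beta>" for n \<beta>
  proof -
    have "measure (P n) {z. 1 * r n < norm z \<and> norm z \<le> \<beta> * r n} \<le>
      p (t n) (x n) * (unit_ball_vol (real DIM('a)) * ((\<beta> * r n) ^ DIM('a) - (1 * r n) ^ DIM('a)))"
    proof (rule annulus_mass_bounds(2)[OF P(1) _ _ emass p_nonneg])
      fix z :: 'a assume z: "1 * r n < norm z" "norm z \<le> \<beta> * r n"
      show "p (t n) z \<le> p (t n) (x n)" using z r[of n] by (intro dec) (auto simp: r_def)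
    qed (use that r[of n] in auto)
    moreover have "q n * (v * (\<beta> ^ d - 1)) =
      p (t n) (x n) * (unit_ball_vol (real DIM('a)) * ((\<beta> * r n) ^ DIM('a) - (1 * r n) ^ DIM('a))) / w n"
      by (simp add: q_def v_def d_def power_mult_distrib algebra_simps)
    ultimately show ?thesis using that by (simp only: divide_right_mono less_imp_le)
  qed
  have ratio: "((\<lambda>b::real. ln b / (b ^ d - 1) / v) \<longlongrightarrow> 1 / real d / v) (at 1)"
    using v by (intro tendsto_divide ln_over_power_minus_one_tendsto d tendsto_const) auto
  \<comment> \<open>The ratio \<open>b\<close> is fixed before \<open>n\<close> grows: it is taken
    so close to 1 that \<open>ln b / (b ^ d - 1) / v\<close> already lies on the required side of
    \<open>a\<close>, and only then is the mass limit used.\<close>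
  have "q \<longlonglongrightarrow> 1 / real d / v"
  proof (rule order_tendstoI)
    fix a assume a: "a < 1 / real d / v"
    have "eventually (\<lambda>b. a < ln b / (b ^ d - 1) / v) (at_right 1)"
      by (rule order_tendstoD(1)[OF tendsto_within_subset[OF ratio] a]) simp
    moreover have "eventually (\<lambda>b::real. b \<in> {1<..<2}) (at_right 1)"
      by (intro eventually_at_right_real) auto
    ultimately have "\<exists>b. a < ln b / (b ^ d - 1) / v \<and> b \<in> {1<..<2}"
      by (intro eventually_happens'[of "at_right 1"] eventually_conj) auto
    then obtain b where b: "a < ln b / (b ^ d - 1) / v" "1 < b" by auto
    have bd: "b ^ d - 1 > 0" using b(2) d by (simp add: one_less_power)
    have "a * (v * (b ^ d - 1)) < ln b" using b(1) bd v by (simp add: field_simps)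
    then have "eventually (\<lambda>n. a * (v * (b ^ d - 1)) < measure (P n) {z. 1 * r n < norm z \<and> norm z \<le> b * r n} / w n) sequentially"
      using mass[of 1 b] b(2) by (intro order_tendstoD(1)) auto
    then show "eventually (\<lambda>n. a < q n) sequentially"
      using wpos
    proof eventually_elim
      case (elim n)
      then have "a * (v * (b ^ d - 1)) < q n * (v * (b ^ d - 1))" using lower[of n b] b(2) by linarith
      then show ?case using bd v by (simp add: mult_less_cancel_right)
    qed
  next
    fix a assume a: "1 / real d / v < a"
    have "eventually (\<lambda>b. ln b / (b ^ d - 1) / v < a) (at_left 1)"
      by (rule order_tendstoD(2)[OF tendsto_within_subset[OF ratio] a]) simp
    moreover have "eventually (\<lambda>b::real. b \<in> {0<..<1}) (at_left 1)"
      by (intro eventually_at_left_real) auto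
    ultimately have "\<exists>b. ln b / (b ^ d - 1) / v < a \<and> b \<in> {0<..<1}"
      by (intro eventually_happens'[of "at_left 1"] eventually_conj) auto
    then obtain b where b: "ln b / (b ^ d - 1) / v < a" "0 < b" "b < 1" by auto
    have bd: "1 - b ^ d > 0" using b d by (simp add: power_Suc_less_one power_less_one_iff)
    have "- ln b / (1 - b ^ d) / v < a"
    proof -
      have "- ln b / (1 - b ^ d) = ln b / (b ^ d - 1)"
        by (metis minus_diff_eq minus_divide_divide minus_minus)
      then show ?thesis using b(1) by simp
    qed
    then have "- ln b < a * (v * (1 - b ^ d))" using bd v by (simp add: field_simps)
    then have "eventually (\<lambda>n. measure (P n) {z. b * r n < norm z \<and> norm z \<le> 1 * r n} / w n < a * (v * (1 - b ^ d))) sequentially"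
      using mass[of b 1] b by (intro order_tendstoD(2)) auto
    then show "eventually (\<lambda>n. q n < a) sequentially"
      using wpos
    proof eventually_elim
      case (elim n)
      then have "q n * (v * (1 - b ^ d)) < a * (v * (1 - b ^ d))" using upper[of n b] b by linarith
      then show ?case using bd v by (simp add: mult_less_cancel_right)
    qed
  qed
  moreover have "q = (\<lambda>n. p (t n) (x n) / (t n * norm (x n) powr (- real DIM('a)) * l (1 / norm (x n))
          * exp (- (t n * \<psi> (1 / norm (x n))))))"
  proof (rule ext)
    fix n
    have "norm (x n) powr (- real DIM('a)) = 1 / r n ^ d"
      using r[of n] by (simp add: r_def d_def powr_minus powr_realpow field_simps)
    then show "q n = p (t n) (x n) / (t n * norm (x n) powr (- real DIM('a)) * l (1 / norm (x n))
          * exp (- (t n * \<psi> (1 / norm (x n)))))" unfolding q_def w_def r_def[symmetric] by simp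
  qed
  moreover have "1 / real d / v = Gamma (real DIM('a) / 2) / (2 * pi powr (real DIM('a) / 2))"
    using unit_ball_vol_times_dim[OF d] by (simp add: v_def d_def mult.commute)
  ultimately show ?thesis by simp
qed

theorem mainTheorem4:
  fixes M :: "'b measure" and X :: "real \<Rightarrow> 'b \<Rightarrow> 'a::euclidean_space"
    and \<nu> :: "'a \<Rightarrow> real" and p :: "real \<Rightarrow> 'a \<Rightarrow> real"
    and \<psi> :: "real \<Rightarrow> real" and l :: "real \<Rightarrow> real"
  assumes levy: "isotropic_unimodal_levy M X \<nu>"
    and dens: "transition_density M X p"
    and p_radial: "\<And>t. t > 0 \<Longrightarrow> radial (p t) \<and> radially_nonincreasing (p t)"
    and psi_radial: "\<And>\<xi>. levy_exponent \<nu> \<xi> = \<psi> (norm \<xi>)"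
    and ell_sv: "slowly_varying_infty l"
    and ell_bdd: "\<exists>B a. \<forall>x\<ge>a. \<bar>l x\<bar> \<le> B"
    and psi_Pi: "de_haan_class l \<psi>"
  shows "\<forall>(t :: nat \<Rightarrow> real) (x :: nat \<Rightarrow> 'a).
     (\<forall>n. 0 < t n \<and> x n \<noteq> 0) \<longrightarrow> t \<longlonglongrightarrow> 0 \<longrightarrow>
     filterlim (\<lambda>n. t n * \<psi> (1 / norm (x n))) at_top sequentially \<longrightarrow>
     (\<lambda>n. p (t n) (x n) /
        (t n * norm (x n) powr (- real DIM('a)) * l (1 / norm (x n))
          * exp (- (t n * \<psi> (1 / norm (x n))))))
     \<longlonglongrightarrow> Gamma (real DIM('a) / 2) / (2 * pi powr (real DIM('a) / 2))"
proof (intro allI impI)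
  fix t :: "nat \<Rightarrow> real" and x :: "nat \<Rightarrow> 'a"
  assume tx: "\<forall>n. 0 < t n \<and> x n \<noteq> 0" and t0: "t \<longlonglongrightarrow> 0"
    and t\<psi>: "filterlim (\<lambda>n. t n * \<psi> (1 / norm (x n))) at_top sequentially"
  have tpos: "\<And>n. 0 < t n" and x0: "\<And>n. x n \<noteq> 0" using tx by auto
  have \<nu>: "levy_density \<nu>" using levy by (auto simp: isotropic_unimodal_levy_def)
  obtain b :: 'a where "b \<in> Basis" using nonempty_Basis by blast
  then have b: "norm b = 1" by simp
  \<comment> \<open>The values of \<psi> are read off along a unit vector. The absolute value is
    there because the hypotheses determine \<psi> only on nonnegative arguments, so measurability
    can only be claimed for \<open>\<psi> \<bar>s\<bar>\<close>.\<close>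
  have \<psi>b: "\<psi> \<bar>s\<bar> = levy_exponent \<nu> (s *\<^sub>R b)" for s by (simp add: psi_radial b)
  have \<psi>_nonneg: "0 \<le> \<psi> s" if "s \<ge> 0" for s
    using levy_exponent_nonneg[OF \<nu>, of "s *\<^sub>R b"] that \<psi>b[of s] by simp
  have \<psi>_meas: "(\<lambda>s. \<psi> \<bar>s\<bar>) \<in> borel_measurable borel"
    unfolding \<psi>b by (rule measurable_compose[OF _ levy_exponent_borel_measurable[OF \<nu>]]) simp
  obtain C where C: "\<And>\<xi>. levy_exponent \<nu> \<xi> \<le> C * (1 + (norm \<xi>)\<^sup>2)"
    using levy_exponent_le[OF \<nu>] by blast
  have \<psi>_le: "\<psi> s \<le> C * (1 + s\<^sup>2)" if "s \<ge> 0" for s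
    using C[of "s *\<^sub>R b"] that \<psi>b[of s] b by simp
  have ux: "filterlim (\<lambda>n. 1 / norm (x n)) at_top sequentially"
    using x0 by (intro filterlim_at_top_if_exponent[OF \<psi>_le tpos t0 _ t\<psi>]) auto
  \<comment> \<open>\<open>l\<close> need not be measurable, so it is replaced by an asymptotically equal measurable function.\<close>
  define m where "m s = \<psi> (exp 1 * s) - \<psi> s" for s
  have lim: "((\<lambda>s. m s / l s) \<longlongrightarrow> 1) at_top"
    using psi_Pi unfolding de_haan_class_def m_def by (metis exp_gt_zero ln_exp)
  have m_meas: "(\<lambda>s. m \<bar>s\<bar>) \<in> borel_measurable borel"
  proof -
    have "(\<lambda>s. \<psi> \<bar>exp 1 * s\<bar>) \<in> borel_measurable borel"
      by (rule measurable_compose[OF _ \<psi>_meas]) simp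
    then show ?thesis unfolding m_def using \<psi>_meas by (intro borel_measurable_diff) (simp_all add: abs_mult)
  qed
  have *: "(\<lambda>n. p (t n) (x n) / (t n * norm (x n) powr (- real DIM('a)) * m (1 / norm (x n))
          * exp (- (t n * \<psi> (1 / norm (x n)))))) \<longlonglongrightarrow> Gamma (real DIM('a) / 2) / (2 * pi powr (real DIM('a) / 2))"
    using p_radial
    by (intro transition_density_tendsto[OF levy dens _ psi_radial \<psi>_nonneg \<psi>_meas m_meas
          slowly_varying_asymptotic[OF ell_sv lim] bounded_asymptotic[OF ell_sv lim ell_bdd]
          de_haan_asymptotic[OF psi_Pi ell_sv lim] tpos t0 x0 ux t\<psi>]) auto
  have "(\<lambda>n. p (t n) (x n) / (t n * norm (x n) powr (- real DIM('a)) * m (1 / norm (x n))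
          * exp (- (t n * \<psi> (1 / norm (x n))))) * (m (1 / norm (x n)) / l (1 / norm (x n))))
      \<longlonglongrightarrow> Gamma (real DIM('a) / 2) / (2 * pi powr (real DIM('a) / 2)) * 1"
    by (intro tendsto_mult * filterlim_compose[OF lim ux])
  then have "(\<lambda>n. p (t n) (x n) / (t n * norm (x n) powr (- real DIM('a)) * m (1 / norm (x n))
          * exp (- (t n * \<psi> (1 / norm (x n))))) * (m (1 / norm (x n)) / l (1 / norm (x n))))
      \<longlonglongrightarrow> Gamma (real DIM('a) / 2) / (2 * pi powr (real DIM('a) / 2))" by simp
  then show "(\<lambda>n. p (t n) (x n) /
        (t n * norm (x n) powr (- real DIM('a)) * l (1 / norm (x n))
          * exp (- (t n * \<psi> (1 / norm (x n))))))
     \<longlonglongrightarrow> Gamma (real DIM('a) / 2) / (2 * pi powr (real DIM('a) / 2))"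
  proof (rule Lim_transform_eventually)
    show "eventually (\<lambda>n. p (t n) (x n) / (t n * norm (x n) powr (- real DIM('a)) * m (1 / norm (x n))
          * exp (- (t n * \<psi> (1 / norm (x n))))) * (m (1 / norm (x n)) / l (1 / norm (x n))) =
        p (t n) (x n) / (t n * norm (x n) powr (- real DIM('a)) * l (1 / norm (x n))
          * exp (- (t n * \<psi> (1 / norm (x n)))))) sequentially"
      using eventually_compose_filterlim[OF asymptotic_eventually_pos[OF ell_sv lim] ux]
      by eventually_elim simp
  qed
qed

end
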